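(* Let $\beta>0$ and $\alpha\in\mathbb{R}$ satisfy $|\alpha|\le\beta$, $\alpha<\beta$, $\alpha\neq 0$ and $|\alpha|+\beta=2$. For every even $N$ and every $S\subset\{1,\dots,N\}$ with $|S|=N/2$, let $\mu_{N,\alpha,\beta,S}$ be the block spin Ising Gibbs measure described in the context, and suppose one observes $n$ independent samples $\sigma^{(1)},\dots,\sigma^{(n)}$ drawn from $\mu_{N,\alpha,\beta,S}$, where $S$ is unknown. Then: \begin{itemize} \item If $\alpha>0$, there exists a positive constant $C_3$ such that there is an algorithm which, from the observations, recovers the block structure $(S,S^c)$ (i.e. the unordered partition $\{S,S^c\}$) exactly with probability at least $1-\delta$ whenever $n\ge C_3\, N\log(N/\delta)$. \item If $\alpha<0$, there exists a positive constant $C_4$ such that there is an algorithm which, from the observations, recovers the block structure $(S,S^c)$ exactly with probability at least $1-\delta$ whenever $n\ge C_4\, \sqrt{N}\log(N/\delta)$. \end{itemize}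
   Context: Block spin Ising model: let $N$ be even and $S\subset\{1,\dots,N\}$ with $|S|=N/2$. For $i,j\in\{1,\dots,N\}$ write $i\sim j$ if $i,j\in S$ or $i,j\in S^c$, and $i\not\sim j$ otherwise. For parameters $\beta>0$, $|\alpha|\le\beta$, the Hamiltonian on $\{-1,+1\}^N$ is $$H_{N,\alpha,\beta,S}(\sigma)=-\frac{\beta}{2N}\sum_{i\sim j}\sigma_i\sigma_j-\frac{\alpha}{2N}\sum_{i\not\sim j}\sigma_i\sigma_j,$$ where the sums run over ordered pairs $(i,j)$, and the Gibbs measure is $\mu_{N,\alpha,\beta,S}(\sigma)=e^{-H_{N,\alpha,\beta,S}(\sigma)}/\sum_{\sigma'}e^{-H_{N,\alpha,\beta,S}(\sigma')}$. An algorithm here is any procedure taking the $n$ observed configurations as input and outputting a partition of $\{1,\dots,N\}$ into two sets of size $N/2$; exact recovery means the output equals $\{S,S^c\}$. The constants $C_3,C_4$ may depend on $\alpha$ and $\beta$ but not on $N$, $n$ or $\delta$. *)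

theory Defs
  imports "HOL-Analysis.Analysis"
begin

text \<open>Spin configurations on the index set {0..<N} (standing for {1,...,N}):
  extensional functions with values in {-1,+1}.\<close>
definition spin_configs :: "nat \<Rightarrow> (nat \<Rightarrow> int) set" where
  "spin_configs N = ({0..<N} \<rightarrow>\<^sub>E {-1, 1})"

definition same_block :: "nat set \<Rightarrow> nat \<Rightarrow> nat \<Rightarrow> bool" where
  "same_block S i j \<longleftrightarrow> (i \<in> S \<longleftrightarrow> j \<in> S)"

definition block_hamiltonian :: "nat \<Rightarrow> real \<Rightarrow> real \<Rightarrow> nat set \<Rightarrow> (nat \<Rightarrow> int) \<Rightarrow> real" where
  "block_hamiltonian N \<alpha> \<beta> S \<sigma> =
     - (\<beta> / (2 * real N)) * (\<Sum>i<N. \<Sum>j<N. if same_block S i j then real_of_int (\<sigma> i * \<sigma> j) else 0)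
     - (\<alpha> / (2 * real N)) * (\<Sum>i<N. \<Sum>j<N. if same_block S i j then 0 else real_of_int (\<sigma> i * \<sigma> j))"

definition partition_fn :: "nat \<Rightarrow> real \<Rightarrow> real \<Rightarrow> nat set \<Rightarrow> real" where
  "partition_fn N \<alpha> \<beta> S = (\<Sum>\<tau>\<in>spin_configs N. exp (- block_hamiltonian N \<alpha> \<beta> S \<tau>))"

definition gibbs :: "nat \<Rightarrow> real \<Rightarrow> real \<Rightarrow> nat set \<Rightarrow> (nat \<Rightarrow> int) \<Rightarrow> real" where
  "gibbs N \<alpha> \<beta> S \<sigma> =
     (if \<sigma> \<in> spin_configs N then exp (- block_hamiltonian N \<alpha> \<beta> S \<sigma>) / partition_fn N \<alpha> \<beta> S else 0)"

text \<open>Probability, under n i.i.d. samples from the Gibbs measure, that the algorithm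
  (given N and the list of observed configurations, outputting one block T of the partition
  {T, complement of T}) recovers the partition {S, S^c} exactly.\<close>
definition recovery_prob ::
  "nat \<Rightarrow> real \<Rightarrow> real \<Rightarrow> nat set \<Rightarrow> nat \<Rightarrow> (nat \<Rightarrow> (nat \<Rightarrow> int) list \<Rightarrow> nat set) \<Rightarrow> real" where
  "recovery_prob N \<alpha> \<beta> S n alg =
     (\<Sum>xs\<in>{xs. set xs \<subseteq> spin_configs N \<and> length xs = n}.
        (\<Prod>k<n. gibbs N \<alpha> \<beta> S (xs ! k)) *
        (if alg N xs = S \<or> alg N xs = {0..<N} - S then 1 else 0))"

end

theory Submission
  imports Defs
begin

text \<open>
  Writing \<open>m\<close> for the magnetization and \<open>s_T\<close> for the difference of the spin sums over \<open>T\<close> and its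
  complement, the energy is a function of \<open>m\<^sup>2\<close> and \<open>s_S\<^sup>2\<close> only, and the estimator maximises the empirical
  sum of \<open>s_T\<^sup>2\<close>. To compare \<open>S\<close> with another half \<open>T\<close>, pair the sites by an involution that exchanges
  both blocks of \<open>S\<close> and both blocks of \<open>T\<close>. Swapping the spins in a pair preserves \<open>m\<close>, so averaging over
  all swaps replaces the spin differences \<open>u\<close> (over \<open>S - T\<close>) and \<open>w\<close> (over \<open>S \<inter> T\<close>) by independent random
  signed sums, with \<open>s_S = u + w\<close> and \<open>s_T = w - u\<close>. Chebyshev's sum inequality then bounds the exponential
  moment (at the Bhattacharyya exponent) of \<open>s_T\<^sup>2 - s_S\<^sup>2\<close> in terms of the number of discordant pairs, which
  a finite energy argument bounds below. This yields order \<open>N log N\<close> samples.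

  If \<open>\<alpha> < 0\<close>, then \<open>s_S\<close> is critical, of order \<open>N powr (3/4)\<close>, and each discordant pair contributes
  \<open>N powr (-1/2)\<close> instead of \<open>1/N\<close> to the exponent, except in the few samples in which \<open>s_S\<close> is small. The
  number of those is controlled uniformly in \<open>T\<close> by anticoncentration of \<open>s_S\<close>.
\<close>

section \<open>Random signed sums\<close>

text \<open>All halves have the same partition function and \<beta> - \<alpha> is positive, so
  maximising the sum of s_T^2 is maximum likelihood. Tilting by half the log-likelihood ratio turns
  the weight for S into the geometric mean of the weights for S and T. As (s_S^2 + s_T^2) / 2 = u^2
  + w^2, this mean lacks the cross term 2uw, so everything rests on how much that cross term adds to
  an orbit sum.

  The obstacle for \<alpha> < 0 is the union bound. About sqrt N log N samples must beat
  exponentially many T, so at distance k a sample has to contribute an exponent of order k / sqrt N,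
  which may be as large as sqrt N. A one-sample moment bound that includes samples with small s_S
  saturates at their probability, far above exp(- sqrt N). Such samples are therefore limited by one
  event that does not mention T, before the union is taken. For the same reason the number of
  discordant pairs is not averaged out there, but kept as a random exponent with its own lower tail
  bound.\<close>

definition signed_sum :: "nat set \<Rightarrow> nat set \<Rightarrow> (nat \<Rightarrow> real) \<Rightarrow> real" where
  "signed_sum A I d = (\<Sum>i\<in>I. if i \<in> A then - d i else d i)"

text \<open>Expanding the double sum of the nonnegative products gives twice the difference of the
  two sides. Similar ordering is assumed pointwise, so the index set itself carries no
  order.\<close>

lemma chebyshev_sum_finite:
  fixes f h :: "'a \<Rightarrow> real"
  assumes "finite X" and "\<And>a b. a \<in> X \<Longrightarrow> b \<in> X \<Longrightarrow> 0 \<le> (f a - f b) * (h a - h b)"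
  shows "sum f X * sum h X \<le> real (card X) * (\<Sum>a\<in>X. f a * h a)"
proof -
  have "0 \<le> (\<Sum>a\<in>X. \<Sum>b\<in>X. (f a - f b) * (h a - h b))"
    using assms(2) by (intro sum_nonneg) auto
  also have "\<dots> = (\<Sum>a\<in>X. \<Sum>b\<in>X. f a * h a) + (\<Sum>a\<in>X. \<Sum>b\<in>X. f b * h b)
      - (\<Sum>a\<in>X. \<Sum>b\<in>X. f a * h b) - (\<Sum>a\<in>X. \<Sum>b\<in>X. f b * h a)"
    by (simp add: sum.distrib sum_subtractf algebra_simps)
  also have "(\<Sum>a\<in>X. \<Sum>b\<in>X. f b * h a) = (\<Sum>a\<in>X. \<Sum>b\<in>X. f a * h b)"
    by (rule sum.swap)
  also have "(\<Sum>a\<in>X. \<Sum>b\<in>X. f a * h b) = sum f X * sum h X"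
    by (simp add: sum_product)
  also have "(\<Sum>a\<in>X. \<Sum>b\<in>X. f a * h a) = real (card X) * (\<Sum>a\<in>X. f a * h a)"
    by (simp add: sum_distrib_left)
  finally show ?thesis by simp
qed

lemma signed_sum_compl:
  assumes "A \<subseteq> I" shows "signed_sum (I - A) I d = - signed_sum A I d"
  unfolding signed_sum_def sum_negf[symmetric] by (intro sum.cong) auto

lemma sum_Pow_compl:
  fixes F :: "nat set \<Rightarrow> real"
  shows "(\<Sum>A\<in>Pow I. F (I - A)) = (\<Sum>A\<in>Pow I. F A)"
  by (rule sum.reindex_bij_witness[where i="\<lambda>A. I - A" and j="\<lambda>A. I - A"]) auto

text \<open>Multiplying out the product over subsets expresses the independence of the signs.
  \<open>A\<close> is the set of flipped indices, so summing over \<open>Pow I\<close> averages over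
  uniform signs, up to normalisation.\<close>

lemma sum_exp_signed_sum:
  assumes "finite I"
  shows "(\<Sum>A\<in>Pow I. exp (y * signed_sum A I d)) = 2 ^ card I * (\<Prod>i\<in>I. cosh (y * d i))"
proof -
  have "(\<Prod>i\<in>I. exp (- (y * d i)) + exp (y * d i))
      = (\<Sum>A\<in>Pow I. (\<Prod>i\<in>A. exp (- (y * d i))) * (\<Prod>i\<in>I - A. exp (y * d i)))"
    using assms by (rule prod_add)
  also have "\<dots> = (\<Sum>A\<in>Pow I. exp (y * signed_sum A I d))"
  proof (rule sum.cong)
    fix A assume "A \<in> Pow I"
    then have AI: "A \<subseteq> I" and fA: "finite A" using assms finite_subset by auto
    have "signed_sum A I d = (\<Sum>i\<in>I - A. d i) + (\<Sum>i\<in>A. - d i)"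
      unfolding signed_sum_def
      by (subst sum.subset_diff[OF AI assms]) (auto intro!: arg_cong2[where f="(+)"] sum.cong)
    then have "y * signed_sum A I d = (\<Sum>i\<in>A. - (y * d i)) + (\<Sum>i\<in>I - A. y * d i)"
      by (simp add: distrib_left right_diff_distrib sum_distrib_left sum_negf)
    then show "(\<Prod>i\<in>A. exp (- (y * d i))) * (\<Prod>i\<in>I - A. exp (y * d i)) = exp (y * signed_sum A I d)"
      using fA assms by (simp add: exp_add exp_sum)
  qed simp
  finally show ?thesis
    by (simp add: cosh_def scaleR_conv_of_real prod_dividef add.commute)
qed

lemma cosh_mono_abs:
  fixes x y :: real
  assumes "\<bar>x\<bar> \<le> \<bar>y\<bar>" shows "cosh x \<le> cosh y"
proof -
  have "cosh \<bar>x\<bar> \<le> cosh \<bar>y\<bar>" using assms by (subst cosh_real_nonneg_le_iff) auto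
  then show ?thesis by (simp add: cosh_real_abs)
qed

text \<open>Complementing the flip set negates the signed sum, so an even weight sees only the even
  part of the exponential.\<close>

lemma sum_even_signed_sum:
  fixes F :: "real \<Rightarrow> real"
  assumes "\<And>x. F (- x) = F x"
  shows "(\<Sum>A\<in>Pow I. F (signed_sum A I d) * exp (y * signed_sum A I d))
       = (\<Sum>A\<in>Pow I. F (signed_sum A I d) * cosh (y * signed_sum A I d))"
proof -
  let ?s = "\<lambda>A. signed_sum A I d"
  have "(\<Sum>A\<in>Pow I. F (?s A) * exp (y * ?s A)) = (\<Sum>A\<in>Pow I. F (?s (I - A)) * exp (y * ?s (I - A)))"
    by (rule sum_Pow_compl[symmetric])
  also have "\<dots> = (\<Sum>A\<in>Pow I. F (?s A) * exp (- (y * ?s A)))"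
    by (intro sum.cong) (auto simp: signed_sum_compl assms)
  finally have "2 * (\<Sum>A\<in>Pow I. F (?s A) * exp (y * ?s A))
      = (\<Sum>A\<in>Pow I. F (?s A) * exp (y * ?s A)) + (\<Sum>A\<in>Pow I. F (?s A) * exp (- (y * ?s A)))" by simp
  also have "\<dots> = 2 * (\<Sum>A\<in>Pow I. F (?s A) * cosh (y * ?s A))"
    unfolding sum.distrib[symmetric] sum_distrib_left
    by (intro sum.cong) (auto simp: cosh_def field_simps)
  finally show ?thesis by simp
qed

text \<open>The Gaussian weight and the hyperbolic cosine are both increasing in the modulus of the
  signed sum, hence positively correlated.\<close>
lemma sum_gauss_cosh_signed_sum:
  assumes "finite I" "0 \<le> k"
  shows "(\<Sum>A\<in>Pow I. exp (k * (signed_sum A I d)\<^sup>2)) * (\<Prod>i\<in>I. cosh (y * d i))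
     \<le> (\<Sum>A\<in>Pow I. exp (k * (signed_sum A I d)\<^sup>2) * cosh (y * signed_sum A I d))"
proof -
  let ?s = "\<lambda>A. signed_sum A I d"
  let ?f = "\<lambda>A. exp (k * (?s A)\<^sup>2)" and ?h = "\<lambda>A. cosh (y * ?s A)"
  have "0 \<le> (?f A - ?f B) * (?h A - ?h B)" for A B
  proof (cases "\<bar>?s A\<bar> \<le> \<bar>?s B\<bar>")
    case True
    then have "?f A \<le> ?f B" using assms(2) by (simp add: mult_left_mono abs_le_square_iff)
    moreover have "?h A \<le> ?h B" using True by (intro cosh_mono_abs) (simp add: abs_mult mult_left_mono)
    ultimately show ?thesis by (intro mult_nonpos_nonpos) auto
  next
    case False
    then have "?f B \<le> ?f A" using assms(2) by (simp add: mult_left_mono abs_le_square_iff)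
    moreover have "?h B \<le> ?h A" using False by (intro cosh_mono_abs) (simp add: abs_mult mult_left_mono)
    ultimately show ?thesis by (intro mult_nonneg_nonneg) auto
  qed
  then have "sum ?f (Pow I) * sum ?h (Pow I) \<le> real (card (Pow I)) * (\<Sum>A\<in>Pow I. ?f A * ?h A)"
    using assms(1) by (intro chebyshev_sum_finite) auto
  moreover have "sum ?h (Pow I) = 2 ^ card I * (\<Prod>i\<in>I. cosh (y * d i))"
    using sum_even_signed_sum[of "\<lambda>_. 1" I d y] sum_exp_signed_sum[OF assms(1), of y d] by simp
  ultimately show ?thesis using assms(1) by (simp add: card_Pow mult.left_commute)
qed

text \<open>Pairs with equal spins contribute cosh 0 = 1; this is how the number of discordant pairs
  becomes an exponent.\<close>

lemma prod_cosh_pair: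
  fixes y :: real
  assumes "finite I" "\<And>i. i \<in> I \<Longrightarrow> d i \<in> {-2, 0, 2}"
  shows "(\<Prod>i\<in>I. cosh (y * d i)) = cosh (2 * y) ^ card {i \<in> I. d i \<noteq> 0}"
proof -
  have "(\<Prod>i\<in>I. cosh (y * d i)) = (\<Prod>i\<in>I. if d i \<noteq> 0 then cosh (2 * y) else 1)"
  proof (intro prod.cong refl)
    fix i assume "i \<in> I"
    from assms(2)[OF this] show "cosh (y * d i) = (if d i \<noteq> 0 then cosh (2 * y) else 1)"
      by (auto simp: mult.commute)
  qed
  also have "\<dots> = cosh (2 * y) ^ card {i \<in> I. d i \<noteq> 0}"
    using assms(1) by (simp add: prod.If_cases Int_def)
  finally show ?thesis .
qed

text \<open>Here w is held fixed and only the signs behind u are averaged: the cross term 2kuw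
  yields a factor cosh(4kw) for each discordant pair, since a nonzero gap has modulus 2.\<close>

lemma gauss_cross_ge:
  assumes "finite I" "0 \<le> k" "\<And>i. i \<in> I \<Longrightarrow> d i \<in> {-2, 0, 2}"
  shows "(\<Sum>A\<in>Pow I. exp (k * (signed_sum A I d)\<^sup>2)) * cosh (4 * k * w) ^ card {i \<in> I. d i \<noteq> 0}
     \<le> (\<Sum>A\<in>Pow I. exp (k * (signed_sum A I d)\<^sup>2) * exp (2 * k * signed_sum A I d * w))"
  using sum_gauss_cosh_signed_sum[OF assms(1,2), of d "2 * k * w"]
    sum_even_signed_sum[of "\<lambda>x. exp (k * x\<^sup>2)" I d "2 * k * w"]
    prod_cosh_pair[of I d "2 * k * w", OF assms(1,3)] by (simp add: mult_ac)

lemma cosh_ge_quadratic: "1 + x\<^sup>2 / 2 \<le> cosh (x::real)"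
proof -
  have *: "1 + x\<^sup>2 / 2 \<le> cosh x" if "0 \<le> x" for x :: real
  proof -
    have a: "x \<le> sinh x" if "0 \<le> x" for x :: real
    proof -
      have "(\<lambda>x. sinh x - x) 0 \<le> (\<lambda>x. sinh x - x) x"
        using that by (intro DERIV_nonneg_imp_nondecreasing[where f="\<lambda>x. sinh x - x"])
          (auto intro!: derivative_eq_intros exI cosh_real_ge_1)
      then show ?thesis by simp
    qed
    have "(\<lambda>x. cosh x - x\<^sup>2 / 2) 0 \<le> (\<lambda>x. cosh x - x\<^sup>2 / 2) x"
      using that by (intro DERIV_nonneg_imp_nondecreasing[where f="\<lambda>x. cosh x - x\<^sup>2 / 2"])
        (auto intro!: derivative_eq_intros exI a)
    then show ?thesis by simp
  qed
  show ?thesis using *[of "\<bar>x\<bar>"] by (simp add: cosh_real_abs)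
qed

text \<open>Averaging over u produces cosh(4kw)^p. Bernoulli's inequality makes this linear in
  cosh(4kw), so that the average over w can be taken by the same correlation inequality; it gives
  cosh(8k)^q, again linearised. The quadratic bound on cosh leaves (8k)^2 / 2 = 32 k^2.\<close>

lemma gauss_pair_general:
  assumes I: "finite I" "finite J" and k: "0 \<le> k"
    and d: "\<And>i. i \<in> I \<union> J \<Longrightarrow> d i \<in> {-2, 0, 2}"
  defines "p \<equiv> card {i \<in> I. d i \<noteq> 0}" and "q \<equiv> card {i \<in> J. d i \<noteq> 0}"
  shows "(\<Sum>A\<in>Pow I. \<Sum>B\<in>Pow J. exp (k * (signed_sum A I d)\<^sup>2) * exp (k * (signed_sum B J d)\<^sup>2)
            * (1 + 32 * k\<^sup>2 * real p * real q))
     \<le> (\<Sum>A\<in>Pow I. \<Sum>B\<in>Pow J. exp (k * (signed_sum A I d)\<^sup>2) * exp (k * (signed_sum B J d)\<^sup>2)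
            * exp (2 * k * signed_sum A I d * signed_sum B J d))"
proof -
  let ?f = "\<lambda>A. exp (k * (signed_sum A I d)\<^sup>2)" and ?g = "\<lambda>B. exp (k * (signed_sum B J d)\<^sup>2)"
  let ?w = "\<lambda>B. signed_sum B J d"
  have bern: "1 + real n * (x - 1) \<le> x ^ n" if "1 \<le> x" for x :: real and n
    using Bernoulli_inequality[of "x - 1" n] that by simp
  have "32 * k\<^sup>2 * real q = real q * ((8 * k)\<^sup>2 / 2)" by (simp add: power2_eq_square)
  also have "\<dots> \<le> real q * (cosh (8 * k) - 1)"
    using cosh_ge_quadratic[of "8 * k"] by (intro mult_left_mono) auto
  also have "\<dots> \<le> cosh (8 * k) ^ q - 1" using bern[of "cosh (8 * k)" q] cosh_real_ge_1[of "8 * k"] by simp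
  finally have q: "32 * k\<^sup>2 * real q \<le> cosh (8 * k) ^ q - 1" .
  have "sum ?g (Pow J) * cosh (8 * k) ^ q \<le> (\<Sum>B\<in>Pow J. ?g B * cosh (4 * k * ?w B))"
    using sum_gauss_cosh_signed_sum[OF I(2) k, of d "4 * k"] prod_cosh_pair[OF I(2), of d "4 * k"] d
    by (simp add: q_def)
  moreover have "sum ?g (Pow J) * (1 + 32 * k\<^sup>2 * real q) \<le> sum ?g (Pow J) * cosh (8 * k) ^ q"
    using q by (intro mult_left_mono sum_nonneg) auto
  ultimately have "sum ?g (Pow J) * (32 * k\<^sup>2 * real q) \<le> (\<Sum>B\<in>Pow J. ?g B * (cosh (4 * k * ?w B) - 1))"
    by (simp add: algebra_simps sum_subtractf sum.distrib sum_distrib_left)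
  then have "sum ?g (Pow J) + real p * (sum ?g (Pow J) * (32 * k\<^sup>2 * real q))
      \<le> sum ?g (Pow J) + real p * (\<Sum>B\<in>Pow J. ?g B * (cosh (4 * k * ?w B) - 1))"
    by (intro add_left_mono mult_left_mono) auto
  also have "\<dots> = (\<Sum>B\<in>Pow J. ?g B * (1 + real p * (cosh (4 * k * ?w B) - 1)))"
    by (simp add: algebra_simps sum_subtractf sum.distrib sum_distrib_left)
  also have "\<dots> \<le> (\<Sum>B\<in>Pow J. ?g B * cosh (4 * k * ?w B) ^ p)"
    by (intro sum_mono mult_left_mono bern cosh_real_ge_1) auto
  finally have *: "sum ?g (Pow J) * (1 + 32 * k\<^sup>2 * real p * real q) \<le> (\<Sum>B\<in>Pow J. ?g B * cosh (4 * k * ?w B) ^ p)"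
    by (simp add: algebra_simps)
  have "(\<Sum>A\<in>Pow I. \<Sum>B\<in>Pow J. ?f A * ?g B * (1 + 32 * k\<^sup>2 * real p * real q))
      = sum ?f (Pow I) * (sum ?g (Pow J) * (1 + 32 * k\<^sup>2 * real p * real q))"
    unfolding sum_distrib_right sum_distrib_left by (subst sum.swap) (simp only: mult.assoc)
  also have "\<dots> \<le> sum ?f (Pow I) * (\<Sum>B\<in>Pow J. ?g B * cosh (4 * k * ?w B) ^ p)"
    using * by (intro mult_left_mono sum_nonneg) auto
  also have "\<dots> = (\<Sum>B\<in>Pow J. ?g B * (sum ?f (Pow I) * cosh (4 * k * ?w B) ^ p))"
    by (simp only: sum_distrib_left mult_ac)
  also have "\<dots> \<le> (\<Sum>B\<in>Pow J. ?g B * (\<Sum>A\<in>Pow I. ?f A * exp (2 * k * signed_sum A I d * ?w B)))"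
    unfolding p_def using gauss_cross_ge[OF I(1) k, of d] d by (intro sum_mono mult_left_mono) auto
  also have "\<dots> = (\<Sum>A\<in>Pow I. \<Sum>B\<in>Pow J. ?f A * ?g B * exp (2 * k * signed_sum A I d * ?w B))"
    unfolding sum_distrib_left by (subst sum.swap) (simp add: mult_ac)
  finally show ?thesis .
qed

text \<open>If the modulus of u + w is at least 2x, then u or w has modulus at least x, and
  averaging over the signs of the other one gains cosh(4kx) per discordant pair. Which of the two is
  large varies, so \<open>r\<close> must lie below both counts, and the hypothesis has to supply
  exponent 2\<theta>.\<close>

lemma gauss_pair_critical:
  assumes I: "finite I" "finite J" and k: "0 \<le> k"
    and d: "\<And>i. i \<in> I \<union> J \<Longrightarrow> d i \<in> {-2, 0, 2}"
    and r: "r \<le> card {i \<in> I. d i \<noteq> 0}" "r \<le> card {i \<in> J. d i \<noteq> 0}"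
    and x: "0 \<le> x" and th: "0 \<le> \<theta>" "exp (2 * \<theta>) \<le> cosh (4 * k * x)"
  shows "(\<Sum>A\<in>Pow I. \<Sum>B\<in>Pow J. exp (k * (signed_sum A I d)\<^sup>2) * exp (k * (signed_sum B J d)\<^sup>2)
            * exp (\<theta> * real r * of_bool (2 * x \<le> \<bar>signed_sum A I d + signed_sum B J d\<bar>)))
     \<le> (\<Sum>A\<in>Pow I. \<Sum>B\<in>Pow J. exp (k * (signed_sum A I d)\<^sup>2) * exp (k * (signed_sum B J d)\<^sup>2)
            * exp (2 * k * signed_sum A I d * signed_sum B J d))"
proof -
  let ?u = "\<lambda>A. signed_sum A I d" and ?w = "\<lambda>B. signed_sum B J d"
  let ?f = "\<lambda>A. exp (k * (?u A)\<^sup>2)" and ?g = "\<lambda>B. exp (k * (?w B)\<^sup>2)"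
  \<comment> \<open>A two-valued lower bound of cosh(4kz)^n for all n at least r, with twice the
    exponent of the conclusion.\<close>
  define h where "h z = 1 + (exp (2 * \<theta> * real r) - 1) * of_bool (x \<le> \<bar>z\<bar>)" for z :: real
  have hle: "h z \<le> cosh (4 * k * z) ^ n" if "r \<le> n" for z n
  proof (cases "x \<le> \<bar>z\<bar>")
    case True
    have "exp (2 * \<theta> * real r) = exp (2 * \<theta>) ^ r" by (metis exp_of_nat2_mult)
    also have "\<dots> \<le> cosh (4 * k * x) ^ r" using th by (intro power_mono) auto
    also have "\<dots> \<le> cosh (4 * k * z) ^ r"
      using True x k by (intro power_mono cosh_mono_abs) (auto simp: abs_mult intro!: mult_left_mono)
    also have "\<dots> \<le> cosh (4 * k * z) ^ n" using that cosh_real_ge_1 by (intro power_increasing) auto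
    finally show ?thesis using True by (simp add: h_def)
  next
    case False then show ?thesis by (simp add: h_def one_le_power cosh_real_ge_1)
  qed
  let ?R = "\<Sum>A\<in>Pow I. \<Sum>B\<in>Pow J. ?f A * ?g B * exp (2 * k * ?u A * ?w B)"
  have 1: "(\<Sum>A\<in>Pow I. \<Sum>B\<in>Pow J. ?f A * ?g B * h (?w B)) \<le> ?R"
  proof -
    have "(\<Sum>A\<in>Pow I. \<Sum>B\<in>Pow J. ?f A * ?g B * h (?w B)) = (\<Sum>B\<in>Pow J. ?g B * (sum ?f (Pow I) * h (?w B)))"
      unfolding sum_distrib_left sum_distrib_right by (subst sum.swap) (simp add: mult_ac)
    also have "\<dots> \<le> (\<Sum>B\<in>Pow J. ?g B * (sum ?f (Pow I) * cosh (4 * k * ?w B) ^ card {i \<in> I. d i \<noteq> 0}))"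
      using hle[OF r(1)] by (intro sum_mono mult_left_mono sum_nonneg) auto
    also have "\<dots> \<le> (\<Sum>B\<in>Pow J. ?g B * (\<Sum>A\<in>Pow I. ?f A * exp (2 * k * ?u A * ?w B)))"
      using gauss_cross_ge[OF I(1) k, of d] d by (intro sum_mono mult_left_mono) auto
    also have "\<dots> = ?R" unfolding sum_distrib_left by (subst sum.swap) (simp add: mult_ac)
    finally show ?thesis .
  qed
  have 2: "(\<Sum>A\<in>Pow I. \<Sum>B\<in>Pow J. ?f A * ?g B * h (?u A)) \<le> ?R"
  proof -
    have "(\<Sum>A\<in>Pow I. \<Sum>B\<in>Pow J. ?f A * ?g B * h (?u A)) = (\<Sum>A\<in>Pow I. ?f A * (sum ?g (Pow J) * h (?u A)))"
      unfolding sum_distrib_left sum_distrib_right by (simp add: mult_ac)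
    also have "\<dots> \<le> (\<Sum>A\<in>Pow I. ?f A * (sum ?g (Pow J) * cosh (4 * k * ?u A) ^ card {i \<in> J. d i \<noteq> 0}))"
      using hle[OF r(2)] by (intro sum_mono mult_left_mono sum_nonneg) auto
    also have "\<dots> \<le> (\<Sum>A\<in>Pow I. ?f A * (\<Sum>B\<in>Pow J. ?g B * exp (2 * k * ?w B * ?u A)))"
      using gauss_cross_ge[OF I(2) k, of d] d by (intro sum_mono mult_left_mono) auto
    also have "\<dots> = ?R" unfolding sum_distrib_left by (simp add: mult_ac)
    finally show ?thesis .
  qed
  \<comment> \<open>The two one-sided bounds are averaged. If one of h u, h w is e^2, the other is
    at least 1, and (1 + e^2) / 2 is at least e = exp(\<theta> r).\<close>
  have "exp (\<theta> * real r * of_bool (2 * x \<le> \<bar>u + w\<bar>)) \<le> (h u + h w) / 2" for u w :: real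
  proof (cases "2 * x \<le> \<bar>u + w\<bar>")
    case True
    define e where "e = exp (\<theta> * real r)"
    have e: "exp (2 * \<theta> * real r) = e\<^sup>2" by (simp add: e_def power2_eq_square flip: exp_add)
    have "1 \<le> e" using th by (simp add: e_def)
    then have e1: "1 \<le> e\<^sup>2" by (simp add: one_le_power)
    have "0 \<le> (e - 1)\<^sup>2" by simp
    then have "e \<le> (1 + e\<^sup>2) / 2" by (simp add: power2_eq_square algebra_simps)
    moreover have "x \<le> \<bar>u\<bar> \<or> x \<le> \<bar>w\<bar>" using True by linarith
    ultimately show ?thesis using True e1 unfolding h_def e by (auto simp: e_def)
  next
    case False
    have "1 \<le> h z" for z using th by (simp add: h_def)
    from this[of u] this[of w] show ?thesis using False by simp
  qed
  then have "(\<Sum>A\<in>Pow I. \<Sum>B\<in>Pow J. ?f A * ?g B * exp (\<theta> * real r * of_bool (2 * x \<le> \<bar>?u A + ?w B\<bar>)))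
     \<le> (\<Sum>A\<in>Pow I. \<Sum>B\<in>Pow J. ?f A * ?g B * ((h (?u A) + h (?w B)) / 2))"
    by (intro sum_mono mult_left_mono) auto
  also have "\<dots> = ((\<Sum>A\<in>Pow I. \<Sum>B\<in>Pow J. ?f A * ?g B * h (?u A))
       + (\<Sum>A\<in>Pow I. \<Sum>B\<in>Pow J. ?f A * ?g B * h (?w B))) / 2"
    by (simp add: sum.distrib distrib_left add_divide_distrib sum_divide_distrib)
  also have "\<dots> \<le> ?R" using 1 2 by simp
  finally show ?thesis .
qed

section \<open>Pair swaps\<close>

definition magnetization :: "nat \<Rightarrow> (nat \<Rightarrow> int) \<Rightarrow> real" where
  "magnetization N \<sigma> = (\<Sum>i<N. real_of_int (\<sigma> i))"

definition block_contrast :: "nat \<Rightarrow> nat set \<Rightarrow> (nat \<Rightarrow> int) \<Rightarrow> real" where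
  "block_contrast N T \<sigma> = (\<Sum>i<N. (if i \<in> T then 1 else - 1) * real_of_int (\<sigma> i))"

text \<open>The same-block and cross-block double sums add up to the squared magnetization and
  differ by the squared contrast; solving for the two sums diagonalises the energy.\<close>

lemma block_hamiltonian_eq:
  "- block_hamiltonian N \<alpha> \<beta> S \<sigma>
     = ((\<alpha> + \<beta>) / 2 * (magnetization N \<sigma>)\<^sup>2 + (\<beta> - \<alpha>) / 2 * (block_contrast N S \<sigma>)\<^sup>2) / (2 * real N)"
proof -
  let ?A = "\<Sum>i<N. \<Sum>j<N. if same_block S i j then real_of_int (\<sigma> i * \<sigma> j) else 0"
  let ?B = "\<Sum>i<N. \<Sum>j<N. if same_block S i j then 0 else real_of_int (\<sigma> i * \<sigma> j)"
  have 1: "?A + ?B = (magnetization N \<sigma>)\<^sup>2"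
    unfolding magnetization_def power2_eq_square sum_product sum.distrib[symmetric]
    by (intro sum.cong) auto
  have 2: "?A - ?B = (block_contrast N S \<sigma>)\<^sup>2"
    unfolding block_contrast_def power2_eq_square sum_product sum_subtractf[symmetric]
    by (intro sum.cong) (auto simp: same_block_def)
  have A: "?A = ((magnetization N \<sigma>)\<^sup>2 + (block_contrast N S \<sigma>)\<^sup>2) / 2"
    and B: "?B = ((magnetization N \<sigma>)\<^sup>2 - (block_contrast N S \<sigma>)\<^sup>2) / 2" using 1 2 by auto
  show ?thesis unfolding block_hamiltonian_def A B
    by (cases "N = 0") (simp_all add: field_simps)
qed

lemma finite_spin_configs: "finite (spin_configs N)"
  unfolding spin_configs_def by (intro finite_PiE) auto

lemma spin_configs_values: "\<sigma> \<in> spin_configs N \<Longrightarrow> i < N \<Longrightarrow> \<sigma> i = -1 \<or> \<sigma> i = 1"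
  unfolding spin_configs_def by (auto simp: PiE_def Pi_def)

locale block_spin =
  fixes \<alpha> \<beta> :: real and N :: nat and S :: "nat set"
  assumes beta_pos: "0 < \<beta>" and alpha_le: "\<bar>\<alpha>\<bar> \<le> \<beta>" and critical: "\<bar>\<alpha>\<bar> + \<beta> = 2"
    and N_even: "even N" and N_pos: "0 < N" and S_sub: "S \<subseteq> {0..<N}" and S_card: "card S = N div 2"
begin

definition weight :: "(nat \<Rightarrow> int) \<Rightarrow> real" where
  "weight \<sigma> = exp (- block_hamiltonian N \<alpha> \<beta> S \<sigma>)"

text \<open>Coefficient of the squared block contrast in the exponent of \<open>weight\<close>;
  \<open>rate / 2\<close> is the Bhattacharyya tilt. At criticality with \<alpha> < 0 it equals 1 /
  (2N).\<close>

definition rate :: real where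
  "rate = (\<beta> - \<alpha>) / (4 * real N)"

lemma weight_pos [simp]: "0 < weight \<sigma>" "0 \<le> weight \<sigma>"
  by (simp_all add: weight_def)

lemma finite_S: "finite S" using S_sub finite_subset by blast

lemma rate_nonneg: "0 \<le> rate"
  using alpha_le beta_pos by (auto simp: rate_def)

end

text \<open>Since \<open>\<pi>\<close> crosses both partitions, it has no fixed point below N, and
  \<open>S\<close> contains exactly one element of each pair. Pairs are therefore indexed by
  \<open>S\<close>, those in \<open>S - T\<close> entering u and those in
  \<open>S \<inter> T\<close> entering w.\<close>

locale block_pairing = block_spin +
  fixes T :: "nat set" and \<pi> :: "nat \<Rightarrow> nat"
  assumes pi_invol [simp]: "\<pi> (\<pi> i) = i"
    and pi_less [simp]: "\<pi> i < N \<longleftrightarrow> i < N"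
    and pi_S: "i < N \<Longrightarrow> \<pi> i \<in> S \<longleftrightarrow> i \<notin> S"
    and pi_T: "i < N \<Longrightarrow> \<pi> i \<in> T \<longleftrightarrow> i \<notin> T"
begin

definition gap :: "(nat \<Rightarrow> int) \<Rightarrow> nat \<Rightarrow> real" where
  "gap \<sigma> i = real_of_int (\<sigma> i - \<sigma> (\<pi> i))"

text \<open>The test is symmetric under \<open>\<pi>\<close>, so naming a pair by one representative
  exchanges both ends, and each swap is an involution.\<close>

definition swap_pairs :: "nat set \<Rightarrow> (nat \<Rightarrow> int) \<Rightarrow> nat \<Rightarrow> int" where
  "swap_pairs C \<sigma> k = (if k \<in> C \<or> \<pi> k \<in> C then \<sigma> (\<pi> k) else \<sigma> k)"

abbreviation discordant :: "nat set \<Rightarrow> (nat \<Rightarrow> int) \<Rightarrow> nat set" where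
  "discordant I \<sigma> \<equiv> {i \<in> I. gap \<sigma> i \<noteq> 0}"

lemma S_less: "i \<in> S \<Longrightarrow> i < N" using S_sub by auto

lemma sum_pairs:
  fixes F :: "nat \<Rightarrow> real"
  shows "(\<Sum>i<N. F i) = (\<Sum>i\<in>S. F i + F (\<pi> i))"
proof -
  have "(\<Sum>i<N. F i) = (\<Sum>i\<in>{..<N} - S. F i) + (\<Sum>i\<in>S. F i)"
    using S_sub by (intro sum.subset_diff) (auto simp: lessThan_atLeast0)
  also have "(\<Sum>i\<in>{..<N} - S. F i) = (\<Sum>i\<in>S. F (\<pi> i))"
    by (rule sum.reindex_bij_witness[where i=\<pi> and j=\<pi>]) (auto simp: pi_S S_less)
  finally show ?thesis by (simp add: sum.distrib)
qed

lemma contrast_T: "block_contrast N T \<sigma> = (\<Sum>i\<in>S \<inter> T. gap \<sigma> i) - (\<Sum>i\<in>S - T. gap \<sigma> i)"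
proof -
  have "block_contrast N T \<sigma> = (\<Sum>i\<in>S. if i \<in> T then gap \<sigma> i else - gap \<sigma> i)"
    unfolding block_contrast_def sum_pairs
    by (intro sum.cong) (auto simp: pi_T S_less gap_def)
  also have "\<dots> = (\<Sum>i\<in>S \<inter> T. gap \<sigma> i) - (\<Sum>i\<in>S - T. gap \<sigma> i)"
    using finite_S by (simp add: sum.If_cases sum_negf Diff_eq)
  finally show ?thesis .
qed

lemma contrast_S: "block_contrast N S \<sigma> = (\<Sum>i\<in>S \<inter> T. gap \<sigma> i) + (\<Sum>i\<in>S - T. gap \<sigma> i)"
proof -
  have "block_contrast N S \<sigma> = (\<Sum>i\<in>S. gap \<sigma> i)"
    unfolding block_contrast_def sum_pairs
    by (intro sum.cong) (auto simp: pi_S S_less gap_def)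
  then show ?thesis using finite_S by (simp add: sum.Int_Diff[of S _ T])
qed

lemma gap_values: "\<sigma> \<in> spin_configs N \<Longrightarrow> i \<in> S \<Longrightarrow> gap \<sigma> i \<in> {-2, 0, 2}"
  using spin_configs_values[of \<sigma> N i] spin_configs_values[of \<sigma> N "\<pi> i"] S_less[of i]
  by (auto simp: gap_def)

lemma swap_pairs_invol: "swap_pairs C (swap_pairs C \<sigma>) = \<sigma>"
  by (auto simp: swap_pairs_def)

lemma swap_pairs_config:
  assumes "C \<subseteq> S" "\<sigma> \<in> spin_configs N" shows "swap_pairs C \<sigma> \<in> spin_configs N"
proof -
  have "swap_pairs C \<sigma> i \<in> {-1, 1}" if "i < N" for i
    using spin_configs_values[OF assms(2), of i] spin_configs_values[OF assms(2), of "\<pi> i"] that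
    by (auto simp: swap_pairs_def)
  moreover have "swap_pairs C \<sigma> i = undefined" if "\<not> i < N" for i
  proof -
    have "i \<notin> C" "\<pi> i \<notin> C" using that assms(1) S_less[of i] S_less[of "\<pi> i"] by auto
    then show ?thesis using that assms(2) by (auto simp: swap_pairs_def spin_configs_def PiE_def extensional_def)
  qed
  ultimately show ?thesis by (auto simp: spin_configs_def PiE_def extensional_def Pi_def)
qed

lemma gap_swap: "C \<subseteq> S \<Longrightarrow> i \<in> S \<Longrightarrow> gap (swap_pairs C \<sigma>) i = (if i \<in> C then - gap \<sigma> i else gap \<sigma> i)"
  using pi_S[of i] S_less[of i] by (auto simp: gap_def swap_pairs_def)

lemma magnetization_swap: "C \<subseteq> S \<Longrightarrow> magnetization N (swap_pairs C \<sigma>) = magnetization N \<sigma>"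
  unfolding magnetization_def sum_pairs by (intro sum.cong) (auto simp: swap_pairs_def)

lemma sum_orbit:
  fixes F :: "(nat \<Rightarrow> int) \<Rightarrow> real"
  shows "(\<Sum>\<sigma>\<in>spin_configs N. \<Sum>C\<in>Pow S. F (swap_pairs C \<sigma>)) = 2 ^ card S * (\<Sum>\<sigma>\<in>spin_configs N. F \<sigma>)"
proof -
  have "(\<Sum>\<sigma>\<in>spin_configs N. F (swap_pairs C \<sigma>)) = (\<Sum>\<sigma>\<in>spin_configs N. F \<sigma>)" if "C \<in> Pow S" for C
    using that by (intro sum.reindex_bij_witness[where i="swap_pairs C" and j="swap_pairs C"])
      (auto simp: swap_pairs_invol swap_pairs_config)
  then have "(\<Sum>C\<in>Pow S. \<Sum>\<sigma>\<in>spin_configs N. F (swap_pairs C \<sigma>)) = 2 ^ card S * (\<Sum>\<sigma>\<in>spin_configs N. F \<sigma>)"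
    using finite_S by (simp add: card_Pow)
  then show ?thesis by (subst sum.swap)
qed

text \<open>Every swap permutes the configurations, so summing over all swaps multiplies both sides
  by 2 to the power |S|, whether or not some swaps fix a configuration. Splitting the swap set along
  T separates the signs of u from those of w.\<close>

lemma sum_mono_orbit:
  fixes F G :: "(nat \<Rightarrow> int) \<Rightarrow> real"
  assumes "\<And>\<sigma>. \<sigma> \<in> spin_configs N \<Longrightarrow>
    (\<Sum>A\<in>Pow (S - T). \<Sum>B\<in>Pow (S \<inter> T). F (swap_pairs (A \<union> B) \<sigma>))
      \<le> (\<Sum>A\<in>Pow (S - T). \<Sum>B\<in>Pow (S \<inter> T). G (swap_pairs (A \<union> B) \<sigma>))"
  shows "(\<Sum>\<sigma>\<in>spin_configs N. F \<sigma>) \<le> (\<Sum>\<sigma>\<in>spin_configs N. G \<sigma>)"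
proof -
  have split: "(\<Sum>C\<in>Pow S. H C) = (\<Sum>A\<in>Pow (S - T). \<Sum>B\<in>Pow (S \<inter> T). H (A \<union> B))"
    for H :: "nat set \<Rightarrow> real"
    unfolding sum.cartesian_product
    by (rule sum.reindex_bij_witness[where i="\<lambda>(A, B). A \<union> B" and j="\<lambda>C. (C - T, C \<inter> T)"])
      (auto simp: Un_Diff_Int)
  have "2 ^ card S * (\<Sum>\<sigma>\<in>spin_configs N. F \<sigma>) \<le> 2 ^ card S * (\<Sum>\<sigma>\<in>spin_configs N. G \<sigma>)"
    unfolding sum_orbit[symmetric] split using assms by (rule sum_mono)
  then show ?thesis by simp
qed

lemma sum_gap_swap:
  assumes "A \<subseteq> S - T" "B \<subseteq> S \<inter> T"
  shows "(\<Sum>i\<in>S - T. gap (swap_pairs (A \<union> B) \<sigma>) i) = signed_sum A (S - T) (gap \<sigma>)"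
    and "(\<Sum>i\<in>S \<inter> T. gap (swap_pairs (A \<union> B) \<sigma>) i) = signed_sum B (S \<inter> T) (gap \<sigma>)"
proof -
  have "A \<union> B \<subseteq> S" using assms by auto
  then show "(\<Sum>i\<in>S - T. gap (swap_pairs (A \<union> B) \<sigma>) i) = signed_sum A (S - T) (gap \<sigma>)"
    "(\<Sum>i\<in>S \<inter> T. gap (swap_pairs (A \<union> B) \<sigma>) i) = signed_sum B (S \<inter> T) (gap \<sigma>)"
    unfolding signed_sum_def using assms by (auto intro!: sum.cong simp: gap_swap)
qed

text \<open>Swaps only change the signs of gaps, so discordance counts are constant on an orbit and
  can be pulled out of the average.\<close>

lemma discordant_swap: "C \<subseteq> S \<Longrightarrow> I \<subseteq> S \<Longrightarrow> discordant I (swap_pairs C \<sigma>) = discordant I \<sigma>"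
  by (auto simp: gap_swap subset_iff split: if_splits)

lemma weight_eq:
  "weight \<sigma> = exp ((\<alpha> + \<beta>) / (4 * real N) * (magnetization N \<sigma>)\<^sup>2)
     * (exp (rate * (\<Sum>i\<in>S - T. gap \<sigma> i)\<^sup>2) * exp (rate * (\<Sum>i\<in>S \<inter> T. gap \<sigma> i)\<^sup>2)
        * exp (2 * rate * (\<Sum>i\<in>S - T. gap \<sigma> i) * (\<Sum>i\<in>S \<inter> T. gap \<sigma> i)))"
  unfolding weight_def block_hamiltonian_eq contrast_S rate_def exp_add[symmetric]
  using N_pos by (intro arg_cong[where f=exp]) (simp add: field_simps power2_eq_square)

text \<open>Tilting at the Bhattacharyya exponent removes exactly the cross term of the weight.\<close>
lemma weight_tilted_eq:
  "weight \<sigma> * exp (rate / 2 * ((block_contrast N T \<sigma>)\<^sup>2 - (block_contrast N S \<sigma>)\<^sup>2))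
   = exp ((\<alpha> + \<beta>) / (4 * real N) * (magnetization N \<sigma>)\<^sup>2)
     * (exp (rate * (\<Sum>i\<in>S - T. gap \<sigma> i)\<^sup>2) * exp (rate * (\<Sum>i\<in>S \<inter> T. gap \<sigma> i)\<^sup>2))"
  unfolding weight_eq contrast_S contrast_T exp_add[symmetric]
  by (intro arg_cong[where f=exp]) (simp add: field_simps power2_eq_square)

text \<open>On one orbit the tilted weight is the weight without its cross term, and restoring the
  cross term multiplies the orbit sum by at least 1 + z. Inverting this by 1 - z/2, which is allowed
  for z at most 1, turns 32 into 16.\<close>

lemma tilted_general:
  "(\<Sum>\<sigma>\<in>spin_configs N. weight \<sigma> * exp (rate / 2 * ((block_contrast N T \<sigma>)\<^sup>2 - (block_contrast N S \<sigma>)\<^sup>2)))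
    \<le> (\<Sum>\<sigma>\<in>spin_configs N. weight \<sigma>
        * (1 - 16 * rate\<^sup>2 * real (card (discordant (S - T) \<sigma>)) * real (card (discordant (S \<inter> T) \<sigma>))))"
proof (rule sum_mono_orbit, goal_cases)
  case (1 \<sigma>)
  let ?u = "\<lambda>A. signed_sum A (S - T) (gap \<sigma>)" and ?w = "\<lambda>B. signed_sum B (S \<inter> T) (gap \<sigma>)"
  define p where "p = card (discordant (S - T) \<sigma>)"
  define q where "q = card (discordant (S \<inter> T) \<sigma>)"
  define m where "m = exp ((\<alpha> + \<beta>) / (4 * real N) * (magnetization N \<sigma>)\<^sup>2)"
  define z where "z = 32 * rate\<^sup>2 * real p * real q"
  have "p + q \<le> card (S - T) + card (S \<inter> T)"
    unfolding p_def q_def using finite_S by (intro add_mono card_mono) auto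
  also have "\<dots> = N div 2" using finite_S S_card card_Int_Diff[of S T] by simp
  finally have pq: "real p + real q \<le> real N / 2" using N_even by (auto elim!: evenE)
  have z0: "0 \<le> z" by (simp add: z_def)
  have "rate * real N = (\<beta> - \<alpha>) / 4" using N_pos by (simp add: rate_def)
  also have "\<dots> \<le> 1 / 2" using critical abs_ge_minus_self[of \<alpha>] by simp
  finally have rN: "rate * real N \<le> 1 / 2" .
  \<comment> \<open>As p + q is at most N/2, the product pq is at most N^2 / 16; together with rate
    * N at most 1/2 this keeps z below 1.\<close>
  have "4 * (real p * real q) \<le> (real p + real q)\<^sup>2"
    using zero_le_power2[of "real p - real q"] by (simp add: power2_eq_square algebra_simps)
  also have "\<dots> \<le> (real N / 2)\<^sup>2" using pq by (intro power_mono) auto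
  finally have "32 * rate\<^sup>2 * (real p * real q) \<le> 32 * rate\<^sup>2 * ((real N / 2)\<^sup>2 / 4)"
    by (intro mult_left_mono) auto
  also have "\<dots> = 2 * (rate * real N)\<^sup>2" by (simp add: power2_eq_square)
  also have "\<dots> \<le> 2 * (1 / 2)\<^sup>2" using rN rate_nonneg by (intro mult_left_mono power_mono) auto
  finally have z1: "z \<le> 1" by (simp add: z_def mult.assoc power2_eq_square)
  \<comment> \<open>The product equals 1 + z (1 - z) / 2.\<close>
  have "1 \<le> (1 + z) * (1 - z / 2)" using z0 z1 mult_left_mono[OF z1 z0] by (simp add: algebra_simps)
  have "(\<Sum>A\<in>Pow (S - T). \<Sum>B\<in>Pow (S \<inter> T). m * (exp (rate * (?u A)\<^sup>2) * exp (rate * (?w B)\<^sup>2)))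
     \<le> (\<Sum>A\<in>Pow (S - T). \<Sum>B\<in>Pow (S \<inter> T). (m * (1 - z / 2)) * (exp (rate * (?u A)\<^sup>2) * exp (rate * (?w B)\<^sup>2) * (1 + z)))"
  proof (intro sum_mono)
    fix A B
    have "m * (exp (rate * (?u A)\<^sup>2) * exp (rate * (?w B)\<^sup>2)) * 1
      \<le> m * (exp (rate * (?u A)\<^sup>2) * exp (rate * (?w B)\<^sup>2)) * ((1 + z) * (1 - z / 2))"
      by (intro mult_left_mono) (use \<open>1 \<le> (1 + z) * (1 - z / 2)\<close> in \<open>auto simp: m_def\<close>)
    then show "m * (exp (rate * (?u A)\<^sup>2) * exp (rate * (?w B)\<^sup>2))
      \<le> (m * (1 - z / 2)) * (exp (rate * (?u A)\<^sup>2) * exp (rate * (?w B)\<^sup>2) * (1 + z))"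
      by (simp only: mult_ac)
  qed
  also have "\<dots> \<le> (\<Sum>A\<in>Pow (S - T). \<Sum>B\<in>Pow (S \<inter> T). (m * (1 - z / 2)) *
      (exp (rate * (?u A)\<^sup>2) * exp (rate * (?w B)\<^sup>2) * exp (2 * rate * ?u A * ?w B)))"
    unfolding sum_distrib_left[symmetric]
  proof (rule mult_left_mono)
    show "0 \<le> m * (1 - z / 2)" using z1 by (simp add: m_def)
  qed (use gauss_pair_general[of "S - T" "S \<inter> T" rate "gap \<sigma>"] finite_S rate_nonneg gap_values[OF 1]
      in \<open>auto simp: z_def p_def q_def\<close>)
  finally have *: "(\<Sum>A\<in>Pow (S - T). \<Sum>B\<in>Pow (S \<inter> T). m * (exp (rate * (?u A)\<^sup>2) * exp (rate * (?w B)\<^sup>2)))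
    \<le> (\<Sum>A\<in>Pow (S - T). \<Sum>B\<in>Pow (S \<inter> T). (m * (1 - z / 2)) *
      (exp (rate * (?u A)\<^sup>2) * exp (rate * (?w B)\<^sup>2) * exp (2 * rate * ?u A * ?w B)))" .
  have left: "weight (swap_pairs (A \<union> B) \<sigma>) * exp (rate / 2 *
      ((block_contrast N T (swap_pairs (A \<union> B) \<sigma>))\<^sup>2 - (block_contrast N S (swap_pairs (A \<union> B) \<sigma>))\<^sup>2))
    = m * (exp (rate * (?u A)\<^sup>2) * exp (rate * (?w B)\<^sup>2))"
    if "A \<in> Pow (S - T)" "B \<in> Pow (S \<inter> T)" for A B
  proof -
    have AB: "A \<subseteq> S - T" "B \<subseteq> S \<inter> T" "A \<union> B \<subseteq> S" using that by auto
    show ?thesis unfolding weight_tilted_eq by (simp only: sum_gap_swap[OF AB(1,2)] magnetization_swap[OF AB(3)] m_def)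
  qed
  have right: "weight (swap_pairs (A \<union> B) \<sigma>) * (1 - 16 * rate\<^sup>2 * real (card (discordant (S - T) (swap_pairs (A \<union> B) \<sigma>)))
      * real (card (discordant (S \<inter> T) (swap_pairs (A \<union> B) \<sigma>))))
    = (m * (1 - z / 2)) * (exp (rate * (?u A)\<^sup>2) * exp (rate * (?w B)\<^sup>2) * exp (2 * rate * ?u A * ?w B))"
    if "A \<in> Pow (S - T)" "B \<in> Pow (S \<inter> T)" for A B
  proof -
    have AB: "A \<subseteq> S - T" "B \<subseteq> S \<inter> T" "A \<union> B \<subseteq> S" using that by auto
    have "1 - 16 * rate\<^sup>2 * real p * real q = 1 - z / 2" by (simp add: z_def)
    then show ?thesis
      by (simp only: weight_eq sum_gap_swap[OF AB(1,2)] magnetization_swap[OF AB(3)]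
          discordant_swap[OF AB(3) Diff_subset] discordant_swap[OF AB(3) Int_lower1] m_def p_def q_def mult_ac)
  qed
  show ?case using * by (simp only: left right cong: sum.cong)
qed

end

section \<open>Finite energy\<close>

definition flip_spin :: "nat \<Rightarrow> (nat \<Rightarrow> int) \<Rightarrow> nat \<Rightarrow> int" where
  "flip_spin i \<sigma> = \<sigma>(i := - \<sigma> i)"

text \<open>A spin flip costs at most a factor exp 4, so a given pair is discordant with conditional
  probability at least 1 / (1 + exp 4). The square treats two pairs at once.\<close>

definition energy_const :: real where
  "energy_const = (1 + exp 4)\<^sup>2"

lemma energy_const_pos [simp]: "0 < energy_const"
  using exp_gt_zero[of "4::real"] unfolding energy_const_def by (intro zero_less_power) linarith

lemma energy_const_nonzero [simp]: "energy_const \<noteq> 0"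
  using energy_const_pos by (simp del: energy_const_pos)

lemma flip_spin_invol: "flip_spin i (flip_spin i \<sigma>) = \<sigma>"
  by (simp add: flip_spin_def)

lemma flip_spin_config: "\<sigma> \<in> spin_configs N \<Longrightarrow> i < N \<Longrightarrow> flip_spin i \<sigma> \<in> spin_configs N"
  by (auto simp: flip_spin_def spin_configs_def PiE_def extensional_def Pi_def)

text \<open>A flip moves the weighted sum by 2, and that sum has modulus at most N. The signs
  \<open>c\<close> cover magnetization and block contrast together.\<close>

lemma weighted_spin_sum_flip:
  fixes c :: "nat \<Rightarrow> real"
  assumes "\<sigma> \<in> spin_configs N" "i < N" "\<And>j. \<bar>c j\<bar> = 1"
  shows "(\<Sum>j<N. c j * real_of_int (\<sigma> j))\<^sup>2 - 4 * real N \<le> (\<Sum>j<N. c j * real_of_int (flip_spin i \<sigma> j))\<^sup>2"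
proof -
  let ?m = "\<Sum>j<N. c j * real_of_int (\<sigma> j)"
  define y where "y = c i * real_of_int (\<sigma> i)"
  have y: "\<bar>y\<bar> = 1" using assms(3)[of i] spin_configs_values[OF assms(1,2)] by (auto simp: y_def abs_mult)
  have "(\<Sum>j<N. c j * real_of_int (flip_spin i \<sigma> j)) = ?m - 2 * y"
  proof -
    have "(\<Sum>j<N. c j * real_of_int (flip_spin i \<sigma> j)) = (\<Sum>j<N. c j * real_of_int (\<sigma> j) - (if j = i then 2 * y else 0))"
      by (intro sum.cong) (auto simp: flip_spin_def y_def)
    then show ?thesis using assms(2) by (simp add: sum_subtractf)
  qed
  moreover have "\<bar>?m\<bar> \<le> (\<Sum>j<N. 1)"
    using spin_configs_values[OF assms(1)] assms(3)
    by (intro order.trans[OF sum_abs] sum_mono) (fastforce simp: abs_mult)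
  then have "\<bar>?m * y\<bar> \<le> real N" using y by (simp add: abs_mult)
  moreover have "y\<^sup>2 = 1" using y by (metis power2_abs one_power2)
  ultimately show ?thesis by (simp add: power2_diff)
qed

context block_spin
begin

text \<open>Both squares lose at most 4N, their coefficients are nonnegative with sum \<beta>, which
  is at most 2, and division by 2N leaves 4.\<close>

lemma weight_flip:
  assumes "\<sigma> \<in> spin_configs N" "i < N"
  shows "weight \<sigma> \<le> exp 4 * weight (flip_spin i \<sigma>)"
proof -
  let ?\<tau> = "flip_spin i \<sigma>"
  have m: "(magnetization N \<sigma>)\<^sup>2 - 4 * real N \<le> (magnetization N ?\<tau>)\<^sup>2"
    using weighted_spin_sum_flip[OF assms, of "\<lambda>_. 1"] by (simp add: magnetization_def)
  have s: "(block_contrast N S \<sigma>)\<^sup>2 - 4 * real N \<le> (block_contrast N S ?\<tau>)\<^sup>2"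
    unfolding block_contrast_def by (rule weighted_spin_sum_flip[OF assms]) auto
  have ab: "0 \<le> (\<alpha> + \<beta>) / 2" "0 \<le> (\<beta> - \<alpha>) / 2" "\<beta> \<le> 2" using alpha_le critical by auto
  have "(\<alpha> + \<beta>) / 2 * ((magnetization N \<sigma>)\<^sup>2 - 4 * real N) + (\<beta> - \<alpha>) / 2 * ((block_contrast N S \<sigma>)\<^sup>2 - 4 * real N)
     \<le> (\<alpha> + \<beta>) / 2 * (magnetization N ?\<tau>)\<^sup>2 + (\<beta> - \<alpha>) / 2 * (block_contrast N S ?\<tau>)\<^sup>2"
    using m s ab by (intro add_mono mult_left_mono)
  then have "(\<alpha> + \<beta>) / 2 * (magnetization N \<sigma>)\<^sup>2 + (\<beta> - \<alpha>) / 2 * (block_contrast N S \<sigma>)\<^sup>2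
     \<le> (\<alpha> + \<beta>) / 2 * (magnetization N ?\<tau>)\<^sup>2 + (\<beta> - \<alpha>) / 2 * (block_contrast N S ?\<tau>)\<^sup>2 + 4 * \<beta> * real N"
    by (simp add: algebra_simps add_divide_distrib diff_divide_distrib)
  moreover have "4 * \<beta> * real N \<le> 4 * 2 * real N" using ab by (intro mult_right_mono mult_left_mono) auto
  ultimately have "((\<alpha> + \<beta>) / 2 * (magnetization N \<sigma>)\<^sup>2 + (\<beta> - \<alpha>) / 2 * (block_contrast N S \<sigma>)\<^sup>2) / (2 * real N)
     \<le> ((\<alpha> + \<beta>) / 2 * (magnetization N ?\<tau>)\<^sup>2 + (\<beta> - \<alpha>) / 2 * (block_contrast N S ?\<tau>)\<^sup>2 + 8 * real N) / (2 * real N)"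
    by (intro divide_right_mono) auto
  then have "- block_hamiltonian N \<alpha> \<beta> S \<sigma> \<le> 4 + - block_hamiltonian N \<alpha> \<beta> S ?\<tau>"
    unfolding block_hamiltonian_eq using N_pos
    by (subst (asm) add_divide_distrib[of _ "8 * real N"]) simp
  then show ?thesis unfolding weight_def exp_add[symmetric] by simp
qed

end

section \<open>Discordant pairs under the finite energy bound\<close>

context block_pairing
begin

lemma pi_neq: "i < N \<Longrightarrow> \<pi> i \<noteq> i" using pi_S[of i] by auto

lemma gap_flip_other:
  assumes "i \<in> S" "j \<in> S" "i \<noteq> j" shows "gap (flip_spin i \<sigma>) j = gap \<sigma> j"
  using assms pi_S[of j] S_less[of j] by (auto simp: gap_def flip_spin_def)

text \<open>Flipping spin i is a bijection of configurations that makes a concordant pair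
  discordant, so the concordant mass is at most exp 4 times the discordant mass. The flip-invariant
  factor \<open>h\<close> turns this into a conditional statement that can be iterated.\<close>

lemma discordant_energy:
  assumes i: "i \<in> S" and h: "\<And>\<sigma>. 0 \<le> h \<sigma>" "\<And>\<sigma>. h (flip_spin i \<sigma>) = h \<sigma>"
  shows "(\<Sum>\<sigma>\<in>spin_configs N. weight \<sigma> * h \<sigma>)
     \<le> (1 + exp 4) * (\<Sum>\<sigma>\<in>spin_configs N. weight \<sigma> * (h \<sigma> * of_bool (gap \<sigma> i \<noteq> 0)))"
proof -
  let ?\<Omega> = "spin_configs N"
  have iN: "i < N" using i S_less by auto
  have "(\<Sum>\<sigma>\<in>?\<Omega>. weight \<sigma> * (h \<sigma> * of_bool (gap \<sigma> i = 0)))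
     \<le> (\<Sum>\<sigma>\<in>?\<Omega>. exp 4 * (weight (flip_spin i \<sigma>) * (h (flip_spin i \<sigma>) * of_bool (gap (flip_spin i \<sigma>) i \<noteq> 0))))"
  proof (rule sum_mono)
    fix \<sigma> assume \<sigma>: "\<sigma> \<in> ?\<Omega>"
    have "of_bool (gap \<sigma> i = 0) \<le> (of_bool (gap (flip_spin i \<sigma>) i \<noteq> 0) :: real)"
      using pi_neq[OF iN] spin_configs_values[OF \<sigma> iN] by (auto simp: gap_def flip_spin_def)
    then have "weight \<sigma> * (h \<sigma> * of_bool (gap \<sigma> i = 0))
      \<le> (exp 4 * weight (flip_spin i \<sigma>)) * (h \<sigma> * of_bool (gap (flip_spin i \<sigma>) i \<noteq> 0))"
      using weight_flip[OF \<sigma> iN] h(1) by (intro mult_mono mult_left_mono) auto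
    then show "weight \<sigma> * (h \<sigma> * of_bool (gap \<sigma> i = 0))
      \<le> exp 4 * (weight (flip_spin i \<sigma>) * (h (flip_spin i \<sigma>) * of_bool (gap (flip_spin i \<sigma>) i \<noteq> 0)))"
      by (simp only: h(2) mult.assoc)
  qed
  also have "\<dots> = exp 4 * (\<Sum>\<sigma>\<in>?\<Omega>. weight \<sigma> * (h \<sigma> * of_bool (gap \<sigma> i \<noteq> 0)))"
    unfolding sum_distrib_left
    by (rule sum.reindex_bij_witness[where i="flip_spin i" and j="flip_spin i"])
      (auto simp: flip_spin_invol flip_spin_config iN)
  finally have "(\<Sum>\<sigma>\<in>?\<Omega>. weight \<sigma> * (h \<sigma> * of_bool (gap \<sigma> i = 0)))
    \<le> exp 4 * (\<Sum>\<sigma>\<in>?\<Omega>. weight \<sigma> * (h \<sigma> * of_bool (gap \<sigma> i \<noteq> 0)))" .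
  moreover have "(\<Sum>\<sigma>\<in>?\<Omega>. weight \<sigma> * h \<sigma>) = (\<Sum>\<sigma>\<in>?\<Omega>. weight \<sigma> * (h \<sigma> * of_bool (gap \<sigma> i = 0)))
    + (\<Sum>\<sigma>\<in>?\<Omega>. weight \<sigma> * (h \<sigma> * of_bool (gap \<sigma> i \<noteq> 0)))"
    unfolding sum.distrib[symmetric] by (intro sum.cong) auto
  ultimately show ?thesis by (simp add: algebra_simps)
qed

text \<open>The indicator for j is absorbed into the factor before i is treated: i and j are
  distinct representatives, so flipping i leaves the pair of j alone.\<close>

lemma discordant_pair_energy:
  assumes ij: "i \<in> S" "j \<in> S" "i \<noteq> j"
    and h: "\<And>\<sigma>. 0 \<le> h \<sigma>" "\<And>\<sigma>. h (flip_spin i \<sigma>) = h \<sigma>" "\<And>\<sigma>. h (flip_spin j \<sigma>) = h \<sigma>"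
  shows "(\<Sum>\<sigma>\<in>spin_configs N. weight \<sigma> * h \<sigma>)
     \<le> energy_const * (\<Sum>\<sigma>\<in>spin_configs N. weight \<sigma> * (h \<sigma> * of_bool (gap \<sigma> i \<noteq> 0 \<and> gap \<sigma> j \<noteq> 0)))"
proof -
  have "(\<Sum>\<sigma>\<in>spin_configs N. weight \<sigma> * h \<sigma>)
      \<le> (1 + exp 4) * (\<Sum>\<sigma>\<in>spin_configs N. weight \<sigma> * (h \<sigma> * of_bool (gap \<sigma> j \<noteq> 0)))"
    using h by (intro discordant_energy ij(2))
  also have "\<dots> \<le> (1 + exp 4) * ((1 + exp 4) *
      (\<Sum>\<sigma>\<in>spin_configs N. weight \<sigma> * (h \<sigma> * of_bool (gap \<sigma> j \<noteq> 0) * of_bool (gap \<sigma> i \<noteq> 0))))"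
    using h by (intro mult_left_mono discordant_energy ij(1)) (auto simp: gap_flip_other ij add_nonneg_nonneg)
  also have "\<dots> = energy_const * (\<Sum>\<sigma>\<in>spin_configs N. weight \<sigma> * (h \<sigma> * of_bool (gap \<sigma> i \<noteq> 0 \<and> gap \<sigma> j \<noteq> 0)))"
    by (simp add: energy_const_def power2_eq_square of_bool_conj mult_ac)
  finally show ?thesis .
qed

text \<open>The product of the counts is a sum of indicators over i in \<open>S - T\<close> and j in
  \<open>S \<inter> T\<close>. These sets are disjoint, so the two-pair bound applies term by
  term.\<close>

lemma weighted_discordant_product:
  "real (card (S - T)) * real (card (S \<inter> T)) * (\<Sum>\<sigma>\<in>spin_configs N. weight \<sigma>)
    \<le> energy_const * (\<Sum>\<sigma>\<in>spin_configs N. weight \<sigma> *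
        (real (card (discordant (S - T) \<sigma>)) * real (card (discordant (S \<inter> T) \<sigma>))))"
proof -
  have c: "real (card (discordant I \<sigma>)) = (\<Sum>i\<in>I. of_bool (gap \<sigma> i \<noteq> 0))" if "finite I" for I \<sigma>
    using that by (simp add: sum.If_cases Int_def of_bool_def)
  have f: "finite (S - T)" "finite (S \<inter> T)" using finite_S by auto
  have "real (card (S - T)) * real (card (S \<inter> T)) * (\<Sum>\<sigma>\<in>spin_configs N. weight \<sigma>)
      = (\<Sum>i\<in>S - T. \<Sum>j\<in>S \<inter> T. \<Sum>\<sigma>\<in>spin_configs N. weight \<sigma> * 1)" by simp
  also have "\<dots> \<le> (\<Sum>i\<in>S - T. \<Sum>j\<in>S \<inter> T. energy_const *
      (\<Sum>\<sigma>\<in>spin_configs N. weight \<sigma> * (1 * of_bool (gap \<sigma> i \<noteq> 0 \<and> gap \<sigma> j \<noteq> 0))))"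
    by (intro sum_mono discordant_pair_energy) auto
  also have "\<dots> = energy_const * (\<Sum>i\<in>S - T. \<Sum>j\<in>S \<inter> T.
      (\<Sum>\<sigma>\<in>spin_configs N. weight \<sigma> * (of_bool (gap \<sigma> i \<noteq> 0) * of_bool (gap \<sigma> j \<noteq> 0))))"
    by (simp only: sum_distrib_left[symmetric] of_bool_conj mult_1)
  also have "\<dots> = energy_const * (\<Sum>\<sigma>\<in>spin_configs N. \<Sum>i\<in>S - T. \<Sum>j\<in>S \<inter> T.
      weight \<sigma> * (of_bool (gap \<sigma> i \<noteq> 0) * of_bool (gap \<sigma> j \<noteq> 0)))"
    by (subst sum.swap[of _ "spin_configs N" "S \<inter> T"]) (subst sum.swap[of _ "spin_configs N" "S - T"], simp)
  also have "\<dots> = energy_const * (\<Sum>\<sigma>\<in>spin_configs N. weight \<sigma> *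
        (real (card (discordant (S - T) \<sigma>)) * real (card (discordant (S \<inter> T) \<sigma>))))"
    unfolding c[OF f(1)] c[OF f(2)] sum_product by (simp only: sum_distrib_left)
  finally show ?thesis .
qed

lemma tilted_general_bound:
  "(\<Sum>\<sigma>\<in>spin_configs N. weight \<sigma> * exp (rate / 2 * ((block_contrast N T \<sigma>)\<^sup>2 - (block_contrast N S \<sigma>)\<^sup>2)))
    \<le> (1 - 16 * rate\<^sup>2 / energy_const * real (card (S - T)) * real (card (S \<inter> T))) * (\<Sum>\<sigma>\<in>spin_configs N. weight \<sigma>)"
proof -
  let ?D = "\<Sum>\<sigma>\<in>spin_configs N. weight \<sigma> * (real (card (discordant (S - T) \<sigma>)) * real (card (discordant (S \<inter> T) \<sigma>)))"
  have "(\<Sum>\<sigma>\<in>spin_configs N. weight \<sigma> * exp (rate / 2 * ((block_contrast N T \<sigma>)\<^sup>2 - (block_contrast N S \<sigma>)\<^sup>2)))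
    \<le> (\<Sum>\<sigma>\<in>spin_configs N. weight \<sigma>
        * (1 - 16 * rate\<^sup>2 * real (card (discordant (S - T) \<sigma>)) * real (card (discordant (S \<inter> T) \<sigma>))))"
    by (rule tilted_general)
  also have "\<dots> = (\<Sum>\<sigma>\<in>spin_configs N. weight \<sigma>) - 16 * rate\<^sup>2 / energy_const * (energy_const * ?D)"
    by (simp add: algebra_simps sum_subtractf sum_distrib_left)
  also have "\<dots> \<le> (\<Sum>\<sigma>\<in>spin_configs N. weight \<sigma>) - 16 * rate\<^sup>2 / energy_const *
      (real (card (S - T)) * real (card (S \<inter> T)) * (\<Sum>\<sigma>\<in>spin_configs N. weight \<sigma>))"
    using weighted_discordant_product energy_const_pos
    by (intro diff_left_mono mult_left_mono) (auto simp: less_imp_le)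
  also have "\<dots> = (1 - 16 * rate\<^sup>2 / energy_const * real (card (S - T)) * real (card (S \<inter> T))) * (\<Sum>\<sigma>\<in>spin_configs N. weight \<sigma>)"
    by (simp add: algebra_simps)
  finally show ?thesis .
qed

end

text \<open>\<open>K\<close> is a matching between \<open>S - T\<close> and
  \<open>S \<inter> T\<close>. Its edges with both ends discordant give one number below both
  discordance counts, as the two-sided critical bound requires, and disjointness of the edges lets
  its lower tail be treated edge by edge.\<close>

locale matched_pairing = block_pairing +
  fixes K :: "(nat \<times> nat) set"
  assumes K_sub: "K \<subseteq> (S - T) \<times> (S \<inter> T)" and inj_fst: "inj_on fst K" and inj_snd: "inj_on snd K"
begin

definition both_discordant :: "(nat \<Rightarrow> int) \<Rightarrow> nat" where
  "both_discordant \<sigma> = card {e \<in> K. gap \<sigma> (fst e) \<noteq> 0 \<and> gap \<sigma> (snd e) \<noteq> 0}"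

lemma finite_K: "finite K"
  using K_sub finite_S by (meson finite_SigmaI finite_Diff finite_Int finite_subset)

lemma both_discordant_le:
  "both_discordant \<sigma> \<le> card (discordant (S - T) \<sigma>)" "both_discordant \<sigma> \<le> card (discordant (S \<inter> T) \<sigma>)"
  "both_discordant \<sigma> \<le> card K"
proof -
  show "both_discordant \<sigma> \<le> card (discordant (S - T) \<sigma>)"
    unfolding both_discordant_def using K_sub finite_S
    by (intro card_inj_on_le[where f=fst] inj_on_subset[OF inj_fst]) auto
  show "both_discordant \<sigma> \<le> card (discordant (S \<inter> T) \<sigma>)"
    unfolding both_discordant_def using K_sub finite_S
    by (intro card_inj_on_le[where f=snd] inj_on_subset[OF inj_snd]) auto
  show "both_discordant \<sigma> \<le> card K"
    unfolding both_discordant_def using finite_K by (intro card_mono) auto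
qed

lemma both_discordant_swap: "C \<subseteq> S \<Longrightarrow> both_discordant (swap_pairs C \<sigma>) = both_discordant \<sigma>"
  unfolding both_discordant_def using K_sub
  by (intro arg_cong[where f=card]) (auto simp: gap_swap split: if_splits)

text \<open>The tilt removes the cross term, and what that term would have added to the orbit sum
  pays for the bonus on configurations with large contrast.\<close>

lemma tilted_critical:
  assumes x: "0 \<le> x" and th: "0 \<le> \<theta>" "exp (2 * \<theta>) \<le> cosh (4 * rate * x)"
  shows "(\<Sum>\<sigma>\<in>spin_configs N. weight \<sigma> *
      (exp (rate / 2 * ((block_contrast N T \<sigma>)\<^sup>2 - (block_contrast N S \<sigma>)\<^sup>2))
       * exp (\<theta> * real (both_discordant \<sigma>) * of_bool (2 * x \<le> \<bar>block_contrast N S \<sigma>\<bar>))))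
    \<le> (\<Sum>\<sigma>\<in>spin_configs N. weight \<sigma>)"
proof (rule sum_mono_orbit, goal_cases)
  case (1 \<sigma>)
  let ?u = "\<lambda>A. signed_sum A (S - T) (gap \<sigma>)" and ?w = "\<lambda>B. signed_sum B (S \<inter> T) (gap \<sigma>)"
  define m where "m = exp ((\<alpha> + \<beta>) / (4 * real N) * (magnetization N \<sigma>)\<^sup>2)"
  have "(\<Sum>A\<in>Pow (S - T). \<Sum>B\<in>Pow (S \<inter> T). m * (exp (rate * (?u A)\<^sup>2) * exp (rate * (?w B)\<^sup>2)
      * exp (\<theta> * real (both_discordant \<sigma>) * of_bool (2 * x \<le> \<bar>?u A + ?w B\<bar>))))
    \<le> (\<Sum>A\<in>Pow (S - T). \<Sum>B\<in>Pow (S \<inter> T). m *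
      (exp (rate * (?u A)\<^sup>2) * exp (rate * (?w B)\<^sup>2) * exp (2 * rate * ?u A * ?w B)))"
    unfolding sum_distrib_left[symmetric]
    by (intro mult_left_mono gauss_pair_critical x th both_discordant_le)
      (use gap_values[OF 1] finite_S rate_nonneg in \<open>auto simp: m_def\<close>)
  moreover have "weight (swap_pairs (A \<union> B) \<sigma>) * (exp (rate / 2 *
      ((block_contrast N T (swap_pairs (A \<union> B) \<sigma>))\<^sup>2 - (block_contrast N S (swap_pairs (A \<union> B) \<sigma>))\<^sup>2))
       * exp (\<theta> * real (both_discordant (swap_pairs (A \<union> B) \<sigma>)) * of_bool (2 * x \<le> \<bar>block_contrast N S (swap_pairs (A \<union> B) \<sigma>)\<bar>)))
    = m * (exp (rate * (?u A)\<^sup>2) * exp (rate * (?w B)\<^sup>2) * exp (\<theta> * real (both_discordant \<sigma>) * of_bool (2 * x \<le> \<bar>?u A + ?w B\<bar>)))"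
    "weight (swap_pairs (A \<union> B) \<sigma>) = m * (exp (rate * (?u A)\<^sup>2) * exp (rate * (?w B)\<^sup>2) * exp (2 * rate * ?u A * ?w B))"
    if "A \<in> Pow (S - T)" "B \<in> Pow (S \<inter> T)" for A B
  proof -
    have AB: "A \<subseteq> S - T" "B \<subseteq> S \<inter> T" "A \<union> B \<subseteq> S" using that by auto
    have c: "block_contrast N S (swap_pairs (A \<union> B) \<sigma>) = ?u A + ?w B"
      by (simp only: contrast_S sum_gap_swap[OF AB(1,2)] add.commute)
    show "weight (swap_pairs (A \<union> B) \<sigma>) * (exp (rate / 2 *
      ((block_contrast N T (swap_pairs (A \<union> B) \<sigma>))\<^sup>2 - (block_contrast N S (swap_pairs (A \<union> B) \<sigma>))\<^sup>2))
       * exp (\<theta> * real (both_discordant (swap_pairs (A \<union> B) \<sigma>)) * of_bool (2 * x \<le> \<bar>block_contrast N S (swap_pairs (A \<union> B) \<sigma>)\<bar>)))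
    = m * (exp (rate * (?u A)\<^sup>2) * exp (rate * (?w B)\<^sup>2) * exp (\<theta> * real (both_discordant \<sigma>) * of_bool (2 * x \<le> \<bar>?u A + ?w B\<bar>)))"
      by (subst mult.assoc[symmetric], subst weight_tilted_eq)
        (simp only: c sum_gap_swap[OF AB(1,2)] magnetization_swap[OF AB(3)] both_discordant_swap[OF AB(3)] m_def mult.assoc)
    show "weight (swap_pairs (A \<union> B) \<sigma>) = m * (exp (rate * (?u A)\<^sup>2) * exp (rate * (?w B)\<^sup>2) * exp (2 * rate * ?u A * ?w B))"
      by (simp only: weight_eq sum_gap_swap[OF AB(1,2)] magnetization_swap[OF AB(3)] m_def)
  qed
  ultimately show ?case by (simp only: cong: sum.cong)
qed

text \<open>The edges are dependent, so they are added one at a time: under the measure reweighted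
  by the edges already treated, the next one has both ends discordant with probability at least
  \<open>1 / energy_const\<close>. For b in {0, 1}, exp(-b) = 1 - (1 - exp(-1)) b.\<close>

lemma both_discordant_exp:
  "(\<Sum>\<sigma>\<in>spin_configs N. weight \<sigma> * exp (- real (both_discordant \<sigma>)))
    \<le> (1 - (1 - exp (- 1)) / energy_const) ^ card K * (\<Sum>\<sigma>\<in>spin_configs N. weight \<sigma>)"
proof -
  define b where "b e \<sigma> = (of_bool (gap \<sigma> (fst e) \<noteq> 0 \<and> gap \<sigma> (snd e) \<noteq> 0) :: real)" for e \<sigma>
  define \<rho> where "\<rho> = 1 - (1 - exp (- 1)) / energy_const"
  have "1 - exp (- 1) \<le> energy_const"
    using exp_gt_zero[of "-1::real"] exp_gt_zero[of "4::real"] by (simp add: energy_const_def power2_eq_square algebra_simps add_nonneg_nonneg)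
  then have \<rho>0: "0 \<le> \<rho>" using energy_const_pos by (simp add: \<rho>_def field_simps)
  have ind: "(\<Sum>\<sigma>\<in>spin_configs N. weight \<sigma> * (\<Prod>e\<in>L. exp (- b e \<sigma>))) \<le> \<rho> ^ card L * (\<Sum>\<sigma>\<in>spin_configs N. weight \<sigma>)"
    if "finite L" "L \<subseteq> K" for L
    using that
  proof (induction L)
    case empty then show ?case by simp
  next
    case (insert e L)
    \<comment> \<open>Weight of the edges already treated. They share no endpoint with
      \<open>e\<close>, so flips at the ends of \<open>e\<close> preserve it.\<close>
    define h where "h \<sigma> = (\<Prod>e\<in>L. exp (- b e \<sigma>))" for \<sigma>
    have eK: "e \<in> K" using insert by auto
    have e: "fst e \<in> S - T" "snd e \<in> S \<inter> T" using eK K_sub by auto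
    have other: "fst e' \<noteq> fst e" "snd e' \<noteq> snd e" "fst e' \<in> S - T" "snd e' \<in> S \<inter> T" if "e' \<in> L" for e'
    proof -
      have "e' \<in> K" "e' \<noteq> e" using that insert by auto
      then show "fst e' \<noteq> fst e" "snd e' \<noteq> snd e" "fst e' \<in> S - T" "snd e' \<in> S \<inter> T"
        using inj_onD[OF inj_fst _ _ eK] inj_onD[OF inj_snd _ _ eK] K_sub by auto
    qed
    have h1: "h (flip_spin (fst e) \<sigma>) = h \<sigma>" for \<sigma>
    proof -
      have "b e' (flip_spin (fst e) \<sigma>) = b e' \<sigma>" if "e' \<in> L" for e'
      proof -
        have "fst e \<noteq> snd e'" using e other[OF that] by auto
        then show ?thesis using e other[OF that] gap_flip_other[of "fst e" "fst e'" \<sigma>] gap_flip_other[of "fst e" "snd e'" \<sigma>]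
          by (auto simp: b_def)
      qed
      then show ?thesis by (simp add: h_def)
    qed
    have h2: "h (flip_spin (snd e) \<sigma>) = h \<sigma>" for \<sigma>
    proof -
      have "b e' (flip_spin (snd e) \<sigma>) = b e' \<sigma>" if "e' \<in> L" for e'
      proof -
        have "snd e \<noteq> fst e'" using e other[OF that] by auto
        then show ?thesis using e other[OF that] gap_flip_other[of "snd e" "fst e'" \<sigma>] gap_flip_other[of "snd e" "snd e'" \<sigma>]
          by (auto simp: b_def)
      qed
      then show ?thesis by (simp add: h_def)
    qed
    have h0: "0 \<le> h \<sigma>" for \<sigma> by (auto simp: h_def intro!: prod_nonneg)
    have ne: "fst e \<noteq> snd e" using e by auto
    have en: "(\<Sum>\<sigma>\<in>spin_configs N. weight \<sigma> * h \<sigma>) \<le> energy_const * (\<Sum>\<sigma>\<in>spin_configs N. weight \<sigma> * (h \<sigma> * b e \<sigma>))"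
      unfolding b_def using discordant_pair_energy[OF _ _ ne h0 h1 h2] e by auto
    have "(\<Sum>\<sigma>\<in>spin_configs N. weight \<sigma> * (\<Prod>e\<in>insert e L. exp (- b e \<sigma>)))
       = (\<Sum>\<sigma>\<in>spin_configs N. weight \<sigma> * h \<sigma> - (1 - exp (- 1)) * (weight \<sigma> * (h \<sigma> * b e \<sigma>)))"
      using insert by (intro sum.cong) (auto simp: h_def b_def algebra_simps)
    also have "\<dots> = (\<Sum>\<sigma>\<in>spin_configs N. weight \<sigma> * h \<sigma>) - (1 - exp (- 1)) / energy_const *
        (energy_const * (\<Sum>\<sigma>\<in>spin_configs N. weight \<sigma> * (h \<sigma> * b e \<sigma>)))"
      using energy_const_pos by (simp add: sum_subtractf sum_distrib_left)
    also have "\<dots> \<le> (\<Sum>\<sigma>\<in>spin_configs N. weight \<sigma> * h \<sigma>) - (1 - exp (- 1)) / energy_const * (\<Sum>\<sigma>\<in>spin_configs N. weight \<sigma> * h \<sigma>)"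
      using en energy_const_pos by (intro diff_left_mono mult_left_mono) (auto simp: less_imp_le)
    also have "\<dots> = \<rho> * (\<Sum>\<sigma>\<in>spin_configs N. weight \<sigma> * h \<sigma>)" by (simp add: \<rho>_def algebra_simps)
    also have "\<dots> \<le> \<rho> * (\<rho> ^ card L * (\<Sum>\<sigma>\<in>spin_configs N. weight \<sigma>))"
      using insert \<rho>0 by (intro mult_left_mono) (auto simp: h_def)
    finally show ?case using insert by (simp add: mult_ac)
  qed
  have "exp (- real (both_discordant \<sigma>)) = (\<Prod>e\<in>K. exp (- b e \<sigma>))" for \<sigma>
  proof -
    have "real (both_discordant \<sigma>) = (\<Sum>e\<in>K. b e \<sigma>)"
      unfolding b_def both_discordant_def using finite_K by (simp add: sum.If_cases Int_def of_bool_def)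
    then show ?thesis using finite_K by (simp add: exp_sum sum_negf flip: sum_negf)
  qed
  then show ?thesis using ind[OF finite_K] by (simp add: \<rho>_def)
qed

end

section \<open>The estimator and the union bound\<close>

definition halves :: "nat \<Rightarrow> nat set set" where
  "halves N = {T. T \<subseteq> {0..<N} \<and> card T = N div 2}"

definition sample_score :: "nat \<Rightarrow> (nat \<Rightarrow> int) list \<Rightarrow> nat set \<Rightarrow> real" where
  "sample_score N xs T = (\<Sum>k<length xs. (block_contrast N T (xs ! k))\<^sup>2)"

text \<open>A half and its complement have equal scores, so for positive N the maximiser is never
  unique, and any choice among the maximisers will do. The parameters \<alpha> and \<beta> do not
  enter, so one estimator serves both regimes.\<close>

definition best_half :: "nat \<Rightarrow> (nat \<Rightarrow> int) list \<Rightarrow> nat set" where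
  "best_half N xs = (SOME T. T \<in> halves N \<and> (\<forall>T'\<in>halves N. sample_score N xs T' \<le> sample_score N xs T))"

definition samples :: "nat \<Rightarrow> nat \<Rightarrow> (nat \<Rightarrow> int) list set" where
  "samples N n = {xs. set xs \<subseteq> spin_configs N \<and> length xs = n}"

lemma finite_halves: "finite (halves N)"
  by (rule finite_subset[of _ "Pow {0..<N}"]) (auto simp: halves_def)

lemma sum_samples_prod:
  fixes g :: "(nat \<Rightarrow> int) \<Rightarrow> real"
  shows "(\<Sum>xs\<in>samples N n. \<Prod>k<n. g (xs ! k)) = (\<Sum>\<sigma>\<in>spin_configs N. g \<sigma>) ^ n"
proof (induction n)
  case 0
  have "samples N 0 = {[]}" by (auto simp: samples_def)
  then show ?case by simp
next
  case (Suc n)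
  have "(\<Sum>xs\<in>samples N (Suc n). \<Prod>k<Suc n. g (xs ! k))
      = (\<Sum>(\<sigma>, xs)\<in>spin_configs N \<times> samples N n. \<Prod>k<Suc n. g ((\<sigma> # xs) ! k))"
    by (rule sum.reindex_bij_witness[where i="\<lambda>(\<sigma>, xs). \<sigma> # xs" and j="\<lambda>xs. (hd xs, tl xs)"])
      (auto simp: samples_def length_Suc_conv)
  also have "\<dots> = (\<Sum>\<sigma>\<in>spin_configs N. \<Sum>xs\<in>samples N n. g \<sigma> * (\<Prod>k<n. g (xs ! k)))"
    by (simp add: sum.cartesian_product prod.lessThan_Suc_shift del: prod.lessThan_Suc)
  also have "\<dots> = (\<Sum>\<sigma>\<in>spin_configs N. g \<sigma>) ^ Suc n"
    by (simp add: sum_distrib_left[symmetric] sum_distrib_right[symmetric] Suc)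
  finally show ?case .
qed

lemma best_half_unique:
  assumes "S \<in> halves N" and "\<And>T. T \<in> halves N \<Longrightarrow> T \<noteq> S \<Longrightarrow> T \<noteq> S' \<Longrightarrow> sample_score N xs T < sample_score N xs S"
  shows "best_half N xs = S \<or> best_half N xs = S'"
proof -
  let ?P = "\<lambda>T. T \<in> halves N \<and> (\<forall>T'\<in>halves N. sample_score N xs T' \<le> sample_score N xs T)"
  have "\<exists>T. ?P T"
  proof -
    let ?M = "Max (sample_score N xs ` halves N)"
    have "?M \<in> sample_score N xs ` halves N" using assms(1) finite_halves by (intro Max_in) auto
    then obtain T where T: "T \<in> halves N" "?M = sample_score N xs T" by auto
    then have "\<forall>T'\<in>halves N. sample_score N xs T' \<le> sample_score N xs T"
      using finite_halves by (metis Max_ge finite_imageI imageI)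
    then show ?thesis using T by auto
  qed
  then have "?P (best_half N xs)" unfolding best_half_def by (rule someI_ex)
  then show ?thesis using assms by (meson leD)
qed

lemma sum_Pow_power_card:
  fixes z :: real
  assumes "finite A" shows "(\<Sum>D\<in>Pow A. z ^ card D) = (1 + z) ^ card A"
  using prod_add[OF assms, of "\<lambda>_. z" "\<lambda>_. 1"] by (simp add: add.commute)

text \<open>Since both sets are halves, \<open>S - T\<close> and \<open>T - S\<close> have equal
  size, and so do \<open>S \<inter> T\<close> and the complement of the union. Bijections between
  these cells and their inverses glue to an involution.\<close>

lemma exists_pairing:
  assumes "even N" "S \<in> halves N" "T \<in> halves N"
  obtains \<pi> :: "nat \<Rightarrow> nat" where "\<And>i. \<pi> (\<pi> i) = i" "\<And>i. \<pi> i < N \<longleftrightarrow> i < N"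
    "\<And>i. i < N \<Longrightarrow> \<pi> i \<in> S \<longleftrightarrow> i \<notin> S" "\<And>i. i < N \<Longrightarrow> \<pi> i \<in> T \<longleftrightarrow> i \<notin> T"
proof -
  have S: "S \<subseteq> {0..<N}" "card S = N div 2" and T: "T \<subseteq> {0..<N}" "card T = N div 2"
    using assms by (auto simp: halves_def)
  have fin: "finite S" "finite T" using S T finite_subset by blast+
  define C where "C = {0..<N} - (S \<union> T)"
  have c1: "card (S - T) = card (T - S)"
    using card_Int_Diff[OF fin(1), of T] card_Int_Diff[OF fin(2), of S] S T by (simp add: Int_commute)
  have "card (S \<union> T) \<le> N" using card_mono[of "{0..<N}" "S \<union> T"] S T by auto
  moreover have "card C = N - card (S \<union> T)"
    unfolding C_def using fin S T by (subst card_Diff_subset) auto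
  moreover have "card S + card T = card (S \<union> T) + card (S \<inter> T)" using fin by (rule card_Un_Int)
  ultimately have c2: "card (S \<inter> T) = card C" using S T assms(1) by (auto elim!: evenE)
  obtain f where f: "bij_betw f (S - T) (T - S)"
    using finite_same_card_bij[OF _ _ c1] fin by auto
  obtain g where g: "bij_betw g (S \<inter> T) C"
    using finite_same_card_bij[OF _ _ c2] fin by (auto simp: C_def)
  define f' where "f' = inv_into (S - T) f"
  define g' where "g' = inv_into (S \<inter> T) g"
  have f1: "f i \<in> T - S" "f' (f i) = i" if "i \<in> S - T" for i
    using f that by (auto simp: f'_def bij_betw_def)
  have f2: "f' i \<in> S - T" "f (f' i) = i" if "i \<in> T - S" for i
    using f that inv_into_into[of i f "S - T"] f_inv_into_f[of i f "S - T"] by (auto simp: f'_def bij_betw_def)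
  have g1: "g i \<in> C" "g' (g i) = i" if "i \<in> S \<inter> T" for i
    using g that by (auto simp: g'_def bij_betw_def)
  have g2: "g' i \<in> S \<inter> T" "g (g' i) = i" if "i \<in> C" for i
    using g that inv_into_into[of i g "S \<inter> T"] f_inv_into_f[of i g "S \<inter> T"] by (auto simp: g'_def bij_betw_def)
  \<comment> \<open>The identity outside {0..<N} makes the involution law hold for all natural
    numbers.\<close>
  define \<pi> where "\<pi> i = (if i \<in> S - T then f i else if i \<in> T - S then f' i
      else if i \<in> S \<inter> T then g i else if i \<in> C then g' i else i)" for i
  have e: "\<pi> i = f i" if "i \<in> S - T" for i using that by (simp add: \<pi>_def)
  have e2: "\<pi> i = f' i" if "i \<in> T - S" for i using that by (simp add: \<pi>_def)
  have e3: "\<pi> i = g i" if "i \<in> S \<inter> T" for i using that by (simp add: \<pi>_def)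
  have e4: "\<pi> i = g' i" if "i \<in> C" for i using that by (auto simp: \<pi>_def C_def)
  have e5: "\<pi> i = i" if "\<not> i < N" for i using that S T by (auto simp: \<pi>_def C_def)
  have cases: "i \<in> S - T \<or> i \<in> T - S \<or> i \<in> S \<inter> T \<or> i \<in> C" if "i < N" for i
    using that by (auto simp: C_def)
  have CN: "i < N" if "i \<in> C \<or> i \<in> S \<or> i \<in> T" for i using that S T by (auto simp: C_def)
  have Cn: "i \<notin> S" "i \<notin> T" if "i \<in> C" for i using that by (auto simp: C_def)
  have main: "\<pi> (\<pi> i) = i \<and> \<pi> i < N \<and> (\<pi> i \<in> S \<longleftrightarrow> i \<notin> S) \<and> (\<pi> i \<in> T \<longleftrightarrow> i \<notin> T)" if iN: "i < N" for i
  proof -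
    consider "i \<in> S - T" | "i \<in> T - S" | "i \<in> S \<inter> T" | "i \<in> C" using cases[OF iN] by blast
    then show ?thesis
    proof cases
      case 1
      show ?thesis unfolding e[OF 1] using f1[OF 1] e2[OF f1(1)[OF 1]] CN[of "f i"] 1 by auto
    next
      case 2
      show ?thesis unfolding e2[OF 2] using f2[OF 2] e[OF f2(1)[OF 2]] CN[of "f' i"] 2 by auto
    next
      case 3
      show ?thesis unfolding e3[OF 3] using g1[OF 3] e4[OF g1(1)[OF 3]] CN[of "g i"] Cn[of "g i"] 3 by auto
    next
      case 4
      show ?thesis unfolding e4[OF 4] using g2[OF 4] e3[OF g2(1)[OF 4]] CN[of "g' i"] Cn[OF 4] by auto
    qed
  qed
  show thesis
    by (rule that[of \<pi>]) (use main e5 in metis)+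
qed

lemma exists_matching:
  fixes A B :: "nat set"
  assumes "finite A" "finite B"
  obtains K where "K \<subseteq> A \<times> B" "inj_on fst K" "inj_on snd K" "card K = min (card A) (card B)"
proof -
  obtain A' where A': "A' \<subseteq> A" "card A' = min (card A) (card B)" "finite A'"
    by (metis min.cobounded1 obtain_subset_with_card_n)
  obtain B' where B': "B' \<subseteq> B" "card B' = min (card A) (card B)" "finite B'"
    by (metis min.cobounded2 obtain_subset_with_card_n)
  obtain h where h: "bij_betw h A' B'"
    using finite_same_card_bij[of A' B'] A' B' by auto
  show thesis
  proof (rule that[of "(\<lambda>a. (a, h a)) ` A'"])
    show "(\<lambda>a. (a, h a)) ` A' \<subseteq> A \<times> B" using A' B' h by (auto simp: bij_betw_def)
    show "inj_on fst ((\<lambda>a. (a, h a)) ` A')" by (auto simp: inj_on_def)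
    show "inj_on snd ((\<lambda>a. (a, h a)) ` A')" using h by (auto simp: bij_betw_def inj_on_def)
    show "card ((\<lambda>a. (a, h a)) ` A') = min (card A) (card B)"
      using A' by (subst card_image) (auto simp: inj_on_def)
  qed
qed

section \<open>Chernoff bounds and summation over the wrong halves\<close>

context block_spin
begin

text \<open>For a half T the two cardinalities are half the Hamming distances from T to S and to the
  complement of S, so the minimum is the distance to the unordered partition.\<close>

abbreviation block_distance :: "nat set \<Rightarrow> nat" where
  "block_distance T \<equiv> min (card (S - T)) (card (S \<inter> T))"

abbreviation wrong_halves :: "nat set set" where
  "wrong_halves \<equiv> halves N - {S, {0..<N} - S}"

definition expect :: "((nat \<Rightarrow> int) \<Rightarrow> real) \<Rightarrow> real" where
  "expect \<phi> = (\<Sum>\<sigma>\<in>spin_configs N. gibbs N \<alpha> \<beta> S \<sigma> * \<phi> \<sigma>)"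

definition sample_prob :: "nat \<Rightarrow> ((nat \<Rightarrow> int) list \<Rightarrow> bool) \<Rightarrow> real" where
  "sample_prob n Q = (\<Sum>xs\<in>samples N n. (\<Prod>k<n. gibbs N \<alpha> \<beta> S (xs ! k)) * of_bool (Q xs))"

lemma S_half: "S \<in> halves N" using S_sub S_card by (simp add: halves_def)

lemma gibbs_nonneg: "0 \<le> gibbs N \<alpha> \<beta> S \<sigma>"
  by (auto simp: gibbs_def partition_fn_def intro!: divide_nonneg_nonneg sum_nonneg)

lemma expect_eq: "expect \<phi> = (\<Sum>\<sigma>\<in>spin_configs N. weight \<sigma> * \<phi> \<sigma>) / (\<Sum>\<sigma>\<in>spin_configs N. weight \<sigma>)"
  unfolding expect_def sum_divide_distrib
  by (intro sum.cong) (auto simp: gibbs_def partition_fn_def weight_def)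

lemma partition_pos: "0 < (\<Sum>\<sigma>\<in>spin_configs N. weight \<sigma>)"
proof -
  have "spin_configs N \<noteq> {}" unfolding spin_configs_def by (auto simp: PiE_eq_empty_iff)
  then show ?thesis by (intro sum_pos finite_spin_configs) auto
qed

lemma expect_le:
  assumes "(\<Sum>\<sigma>\<in>spin_configs N. weight \<sigma> * \<phi> \<sigma>) \<le> c * (\<Sum>\<sigma>\<in>spin_configs N. weight \<sigma>)"
  shows "expect \<phi> \<le> c"
  unfolding expect_eq using assms partition_pos by (simp add: divide_le_eq)

lemma expect_nonneg: "(\<And>\<sigma>. \<sigma> \<in> spin_configs N \<Longrightarrow> 0 \<le> \<phi> \<sigma>) \<Longrightarrow> 0 \<le> expect \<phi>"
  unfolding expect_def by (intro sum_nonneg mult_nonneg_nonneg gibbs_nonneg)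

lemma sample_prob_True: "sample_prob n (\<lambda>_. True) = 1"
proof -
  have "expect (\<lambda>_. 1) = 1" using partition_pos by (simp add: expect_eq)
  then show ?thesis using sum_samples_prod[of "gibbs N \<alpha> \<beta> S" n N]
    by (simp add: sample_prob_def expect_def)
qed

lemma prod_gibbs_nonneg: "0 \<le> (\<Prod>k<n. gibbs N \<alpha> \<beta> S (xs ! k))"
  by (intro prod_nonneg) (simp add: gibbs_nonneg)

text \<open>Markov's inequality for a product statistic, whose mean factorises because the samples
  are independent.\<close>

lemma chernoff:
  assumes "\<And>\<sigma>. 0 \<le> \<phi> \<sigma>" and "\<And>xs. xs \<in> samples N n \<Longrightarrow> Q xs \<Longrightarrow> c \<le> (\<Prod>k<n. \<phi> (xs ! k))"
  shows "c * sample_prob n Q \<le> expect \<phi> ^ n"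
proof -
  have "c * sample_prob n Q \<le> (\<Sum>xs\<in>samples N n. (\<Prod>k<n. gibbs N \<alpha> \<beta> S (xs ! k)) * (\<Prod>k<n. \<phi> (xs ! k)))"
    unfolding sample_prob_def sum_distrib_left
  proof (rule sum_mono)
    fix xs assume xs: "xs \<in> samples N n"
    have "c * of_bool (Q xs) \<le> (\<Prod>k<n. \<phi> (xs ! k))"
      using assms(2)[OF xs] assms(1) by (auto intro!: prod_nonneg)
    from mult_left_mono[OF this prod_gibbs_nonneg[of xs n]]
    show "c * ((\<Prod>k<n. gibbs N \<alpha> \<beta> S (xs ! k)) * of_bool (Q xs))
       \<le> (\<Prod>k<n. gibbs N \<alpha> \<beta> S (xs ! k)) * (\<Prod>k<n. \<phi> (xs ! k))" by (simp only: mult_ac)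
  qed
  also have "\<dots> = (\<Sum>xs\<in>samples N n. \<Prod>k<n. gibbs N \<alpha> \<beta> S (xs ! k) * \<phi> (xs ! k))"
    by (simp add: prod.distrib)
  also have "\<dots> = expect \<phi> ^ n" unfolding expect_def by (rule sum_samples_prod)
  finally show ?thesis .
qed

lemma sample_prob_disj:
  assumes "\<And>xs. xs \<in> samples N n \<Longrightarrow> Q xs \<Longrightarrow> Q1 xs \<or> Q2 xs"
  shows "sample_prob n Q \<le> sample_prob n Q1 + sample_prob n Q2"
  unfolding sample_prob_def sum.distrib[symmetric] distrib_left[symmetric]
  using assms by (intro sum_mono mult_left_mono prod_gibbs_nonneg) auto

text \<open>The event \<open>G\<close> does not refer to T, so its complement is paid for once
  rather than once per competitor.\<close>

lemma recovery_union_bound: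
  "1 - sample_prob n (\<lambda>xs. \<not> G xs)
     - (\<Sum>T\<in>wrong_halves. sample_prob n (\<lambda>xs. G xs \<and> sample_score N xs S \<le> sample_score N xs T))
   \<le> recovery_prob N \<alpha> \<beta> S n best_half"
proof -
  let ?g = "\<lambda>xs. \<Prod>k<n. gibbs N \<alpha> \<beta> S (xs ! k)"
  let ?F = "\<lambda>T xs. G xs \<and> sample_score N xs S \<le> sample_score N xs T"
  have "1 = (\<Sum>xs\<in>samples N n. ?g xs * 1)" using sample_prob_True[of n] by (simp add: sample_prob_def)
  also have "\<dots> \<le> (\<Sum>xs\<in>samples N n. ?g xs * ((if best_half N xs = S \<or> best_half N xs = {0..<N} - S then 1 else 0)
      + of_bool (\<not> G xs) + (\<Sum>T\<in>wrong_halves. of_bool (?F T xs))))"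
  proof (intro sum_mono mult_left_mono prod_gibbs_nonneg)
    fix xs
    have s0: "(0::real) \<le> (\<Sum>T\<in>wrong_halves. of_bool (?F T xs))" by (intro sum_nonneg) auto
    show "(1::real) \<le> (if best_half N xs = S \<or> best_half N xs = {0..<N} - S then 1 else 0)
      + of_bool (\<not> G xs) + (\<Sum>T\<in>wrong_halves. of_bool (?F T xs))"
    proof (cases "(best_half N xs = S \<or> best_half N xs = {0..<N} - S) \<or> \<not> G xs")
      case True then show ?thesis using s0 by auto
    next
      case False
      then obtain T where T: "T \<in> wrong_halves" "?F T xs"
        using best_half_unique[OF S_half, of "{0..<N} - S" xs] by (meson DiffI insertE empty_iff not_less)
      have "(\<Sum>T\<in>{T}. of_bool (?F T xs)) \<le> (\<Sum>T\<in>wrong_halves. of_bool (?F T xs) :: real)"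
        using T finite_halves by (intro sum_mono2) auto
      then show ?thesis using T False by simp
    qed
  qed
  also have "\<dots> = recovery_prob N \<alpha> \<beta> S n best_half + sample_prob n (\<lambda>xs. \<not> G xs) + (\<Sum>T\<in>wrong_halves. sample_prob n (?F T))"
    unfolding recovery_prob_def sample_prob_def samples_def[symmetric] distrib_left sum.distrib sum_distrib_left
    by (subst sum.swap[of _ wrong_halves]) simp
  finally show ?thesis by simp
qed

text \<open>The symmetric difference of S and T has size 2 |S - T|, whence the square of z. It
  determines T, so the sum is at most that of z^|D| over nonempty D, which is (1 + z)^N - 1 and
  hence at most 2Nz. Complementing T handles the terms with |S \<inter> T| and doubles the
  bound.\<close>

lemma wrong_half_sum:
  assumes z: "0 \<le> z" "real N * z \<le> 1"
  shows "(\<Sum>T\<in>wrong_halves. (z\<^sup>2) ^ block_distance T) \<le> 4 * real N * z"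
proof -
  have card_compl: "card ({0..<N} - T) = N div 2" if "T \<in> halves N" for T
    using that N_even by (auto simp: halves_def card_Diff_subset finite_subset elim!: evenE)
  have one: "(\<Sum>T\<in>wrong_halves. (z\<^sup>2) ^ card (S - T)) \<le> 2 * real N * z"
  proof -
    let ?D = "\<lambda>T. (S - T) \<union> (T - S)"
    have e: "(z\<^sup>2) ^ card (S - T) = z ^ card (?D T)" if "T \<in> wrong_halves" for T
    proof -
      have "T \<subseteq> {0..<N}" and cT: "card T = N div 2" using that by (simp_all add: halves_def)
      then have fT: "finite T" by (auto intro: finite_subset)
      have "card (T - S) = card (S - T)"
        using card_Int_Diff[OF finite_S, of T] card_Int_Diff[OF fT, of S] S_card cT by (simp add: Int_commute)
      then have "card (?D T) = 2 * card (S - T)" using fT finite_S by (subst card_Un_disjoint) auto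
      then show ?thesis by (simp add: power_mult)
    qed
    have "(\<Sum>T\<in>wrong_halves. (z\<^sup>2) ^ card (S - T)) = (\<Sum>T\<in>wrong_halves. z ^ card (?D T))"
      using e by (rule sum.cong[OF refl])
    also have "\<dots> = (\<Sum>D\<in>?D ` wrong_halves. z ^ card D)"
    proof -
      have "inj_on ?D wrong_halves"
        by (rule inj_on_inverseI[where g="\<lambda>D. (S - D) \<union> (D - S)"]) blast
      then show ?thesis by (simp add: sum.reindex)
    qed
    also have "\<dots> \<le> (\<Sum>D\<in>Pow {0..<N} - {{}}. z ^ card D)"
    proof (rule sum_mono2)
      have "?D T \<subseteq> {0..<N}" "?D T \<noteq> {}" if "T \<in> wrong_halves" for T
      proof -
        have "T \<subseteq> {0..<N}" "T \<noteq> S" using that by (simp_all add: halves_def)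
        then show "?D T \<subseteq> {0..<N}" "?D T \<noteq> {}" using S_sub by blast+
      qed
      then show "?D ` wrong_halves \<subseteq> Pow {0..<N} - {{}}" by blast
    qed (use z in auto)
    also have "\<dots> = (1 + z) ^ N - 1"
      using sum_Pow_power_card[of "{0..<N}" z] by (subst sum_diff) auto
    also have "(1 + z) ^ N \<le> exp z ^ N" using z by (intro power_mono) auto
    also have "\<dots> = exp (real N * z)" by (simp add: exp_of_nat_mult)
    also have "\<dots> \<le> 1 + real N * z + (real N * z)\<^sup>2" using z by (intro exp_bound) auto
    also have "(real N * z)\<^sup>2 \<le> real N * z"
      using z mult_left_mono[OF z(2), of "real N * z"] by (simp add: power2_eq_square)
    finally show ?thesis by (simp add: mult_ac)
  qed
  have "(\<Sum>T\<in>wrong_halves. (z\<^sup>2) ^ card (S \<inter> T)) = (\<Sum>T\<in>wrong_halves. (z\<^sup>2) ^ card (S - T))"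
  proof (rule sum.reindex_bij_witness[where i="\<lambda>T. {0..<N} - T" and j="\<lambda>T. {0..<N} - T"])
    have *: "{0..<N} - T \<in> wrong_halves" "{0..<N} - ({0..<N} - T) = T" if T: "T \<in> wrong_halves" for T
    proof -
      have TN: "T \<subseteq> {0..<N}" and ne: "T \<noteq> S" "T \<noteq> {0..<N} - S" and TH: "T \<in> halves N"
        using T by (simp_all add: halves_def)
      show c: "{0..<N} - ({0..<N} - T) = T" using TN by blast
      have "{0..<N} - ({0..<N} - S) = S" using S_sub by blast
      then have "{0..<N} - T \<noteq> S" "{0..<N} - T \<noteq> {0..<N} - S" using c ne by metis+
      moreover have "{0..<N} - T \<in> halves N" using card_compl[OF TH] by (simp add: halves_def)
      ultimately show "{0..<N} - T \<in> wrong_halves" by simp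
    qed
    show "{0..<N} - T \<in> wrong_halves" "{0..<N} - ({0..<N} - T) = T" if "T \<in> wrong_halves" for T
      using *[OF that] by auto
    show "{0..<N} - T \<in> wrong_halves" "{0..<N} - ({0..<N} - T) = T" if "T \<in> wrong_halves" for T
      using *[OF that] by auto
    show "(z\<^sup>2) ^ card (S - ({0..<N} - T)) = (z\<^sup>2) ^ card (S \<inter> T)" for T
    proof -
      have "S - ({0..<N} - T) = S \<inter> T" using S_sub by auto
      then show ?thesis by simp
    qed
  qed
  moreover have "(\<Sum>T\<in>wrong_halves. (z\<^sup>2) ^ block_distance T) \<le> (\<Sum>T\<in>wrong_halves. (z\<^sup>2) ^ card (S - T) + (z\<^sup>2) ^ card (S \<inter> T))"
    by (intro sum_mono) (auto simp: min_def)
  ultimately show ?thesis using one by (simp add: sum.distrib)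
qed

lemma recovery_from_distance_bound:
  assumes \<delta>: "0 < \<delta>" "\<delta> < 1" and y: "0 \<le> y" "y \<le> exp (- 12 * ln (real N / \<delta>))"
    and G: "sample_prob n (\<lambda>xs. \<not> G xs) \<le> \<delta> / 2"
    and T: "\<And>T. T \<in> wrong_halves \<Longrightarrow>
      sample_prob n (\<lambda>xs. G xs \<and> sample_score N xs S \<le> sample_score N xs T) \<le> 2 * y ^ block_distance T"
  shows "1 - \<delta> \<le> recovery_prob N \<alpha> \<beta> S n best_half"
proof -
  \<comment> \<open>The square root of (\<delta> / N)^12, the bound on y. It makes Nz at most
    \<delta>/32, so the wrong halves cost at most 8Nz, which is at most \<delta>/4, next to
    \<delta>/2 for the complement of G.\<close>
  define z where "z = (\<delta> / real N) ^ 6"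
  have N2: "2 \<le> real N" using N_even N_pos by (auto elim!: evenE)
  have "exp (- 12 * ln (real N / \<delta>)) = (\<delta> / real N) ^ 12"
  proof -
    have "exp (- 12 * ln (real N / \<delta>)) = exp (real 12 * ln (\<delta> / real N))"
      using \<delta> N2 by (simp add: ln_div)
    also have "\<dots> = (\<delta> / real N) ^ 12" using \<delta> N2 by (subst exp_of_nat_mult) simp
    finally show ?thesis .
  qed
  then have yz: "y \<le> z\<^sup>2" using y by (simp add: z_def flip: power_mult)
  have z0: "0 \<le> z" using \<delta> by (simp add: z_def)
  have q: "0 \<le> \<delta> / real N" "\<delta> / real N \<le> 1 / 2" using \<delta> N2 by (auto simp: field_simps)
  have "real N * z = \<delta> * (\<delta> / real N) ^ 5" using N2 by (simp add: z_def power_eq_if)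
  also have "\<dots> \<le> \<delta> * (1 / 2) ^ 5" using q \<delta> by (intro mult_left_mono power_mono) auto
  finally have Nz: "real N * z \<le> \<delta> / 32" by (simp add: power_eq_if)
  have "(\<Sum>T\<in>wrong_halves. sample_prob n (\<lambda>xs. G xs \<and> sample_score N xs S \<le> sample_score N xs T))
     \<le> (\<Sum>T\<in>wrong_halves. 2 * (z\<^sup>2) ^ block_distance T)"
    using T power_mono[OF yz y(1)] by (intro sum_mono) (meson mult_left_mono order_trans zero_le_numeral)
  also have "\<dots> \<le> 2 * (4 * real N * z)"
    using wrong_half_sum[OF z0] Nz \<delta> by (simp add: mult_ac flip: sum_distrib_left)
  also have "\<dots> \<le> \<delta> / 4" using Nz by simp
  finally show ?thesis using recovery_union_bound[of n G] G \<delta> by simp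
qed

lemma score_fail_exp:
  assumes "xs \<in> samples N n" "sample_score N xs S \<le> sample_score N xs T" "0 \<le> c"
  shows "1 \<le> (\<Prod>k<n. exp (c * ((block_contrast N T (xs ! k))\<^sup>2 - (block_contrast N S (xs ! k))\<^sup>2)))"
proof -
  have "length xs = n" using assms(1) by (simp add: samples_def)
  then have "0 \<le> c * (\<Sum>k<n. (block_contrast N T (xs ! k))\<^sup>2 - (block_contrast N S (xs ! k))\<^sup>2)"
    using assms(2,3) by (auto simp: sample_score_def sum_subtractf)
  then show ?thesis by (simp add: exp_sum[symmetric] sum_distrib_left)
qed

lemma obtain_matched_pairing:
  assumes "T \<in> halves N"
  obtains \<pi> K where "matched_pairing \<alpha> \<beta> N S T \<pi> K" "card K = block_distance T"
proof -
  obtain \<pi> where p: "\<And>i. \<pi> (\<pi> i) = i" "\<And>i. \<pi> i < N \<longleftrightarrow> i < N"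
    "\<And>i. i < N \<Longrightarrow> \<pi> i \<in> S \<longleftrightarrow> i \<notin> S" "\<And>i. i < N \<Longrightarrow> \<pi> i \<in> T \<longleftrightarrow> i \<notin> T"
    using exists_pairing[OF N_even S_half assms] by metis
  obtain K where K: "K \<subseteq> (S - T) \<times> (S \<inter> T)" "inj_on fst K" "inj_on snd K" "card K = block_distance T"
    using exists_matching[of "S - T" "S \<inter> T"] finite_S by auto
  have "matched_pairing \<alpha> \<beta> N S T \<pi> K"
    by unfold_locales (use p K in auto)
  then show thesis using K(4) by (rule that)
qed

text \<open>The larger of |S - T| and |S \<inter> T| is at least N/4, so their product is at least
  N/4 times the block distance d, and the one-sample moment is at most exp(-c d / N). Requiring c n
  / N to be at least 12 ln(N / \<delta>) gives 48 = 12 * 4.\<close>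

lemma recovery_general:
  assumes \<delta>: "0 < \<delta>" "\<delta> < 1" and ab: "\<alpha> < \<beta>"
    and n: "48 * energy_const / (\<beta> - \<alpha>)\<^sup>2 * real N * ln (real N / \<delta>) \<le> real n"
  shows "1 - \<delta> \<le> recovery_prob N \<alpha> \<beta> S n best_half"
proof -
  define c where "c = (\<beta> - \<alpha>)\<^sup>2 / (4 * energy_const)"
  have c0: "0 < c" using ab by (simp add: c_def)
  define y where "y = exp (- (c * real n / real N))"
  have "12 / c * real N * ln (real N / \<delta>) \<le> real n" using n by (simp add: c_def mult_ac)
  then have "12 * ln (real N / \<delta>) \<le> c * real n / real N" using c0 N_pos by (simp add: field_simps)
  then have y: "0 \<le> y" "y \<le> exp (- 12 * ln (real N / \<delta>))" by (simp_all add: y_def)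
  show ?thesis
  proof (rule recovery_from_distance_bound[OF \<delta> y, where G="\<lambda>_. True"])
    show "sample_prob n (\<lambda>xs. \<not> True) \<le> \<delta> / 2" using \<delta> by (simp add: sample_prob_def)
    fix T assume T: "T \<in> wrong_halves"
    then obtain \<pi> K where "matched_pairing \<alpha> \<beta> N S T \<pi> K" using obtain_matched_pairing[of T] by (metis DiffD1)
    then interpret matched_pairing \<alpha> \<beta> N S T \<pi> K .
    define \<phi> where "\<phi> \<sigma> = exp (rate / 2 * ((block_contrast N T \<sigma>)\<^sup>2 - (block_contrast N S \<sigma>)\<^sup>2))" for \<sigma>
    have s: "card (S - T) + card (S \<inter> T) = N div 2" using finite_S S_card card_Int_Diff[of S T] by simp
    then have "block_distance T * N \<le> 4 * (card (S - T) * card (S \<inter> T))"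
    proof -
      have "N = 2 * (card (S - T) + card (S \<inter> T))" using s N_even by simp
      then show ?thesis by (simp add: min_def algebra_simps mult_le_mono)
    qed
    then have ov: "real (block_distance T) * real N \<le> 4 * (real (card (S - T)) * real (card (S \<inter> T)))"
      by (metis of_nat_le_iff of_nat_mult of_nat_numeral)
    have "expect \<phi> \<le> 1 - 16 * rate\<^sup>2 / energy_const * real (card (S - T)) * real (card (S \<inter> T))"
      using tilted_general_bound by (intro expect_le) (simp add: \<phi>_def)
    also have "\<dots> \<le> exp (- (16 * rate\<^sup>2 / energy_const * real (card (S - T)) * real (card (S \<inter> T))))"
      by (metis exp_ge_add_one_self uminus_add_conv_diff add.commute)
    also have "\<dots> \<le> exp (- (c / real N * real (block_distance T)))"
    proof -
      have "c / real N * real (block_distance T) = 4 * rate\<^sup>2 / energy_const * (real (block_distance T) * real N)"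
        using N_pos by (simp add: c_def rate_def field_simps power2_eq_square)
      also have "\<dots> \<le> 4 * rate\<^sup>2 / energy_const * (4 * (real (card (S - T)) * real (card (S \<inter> T))))"
        using ov by (intro mult_left_mono) (auto simp: less_imp_le)
      finally show ?thesis by (simp add: mult_ac)
    qed
    finally have "expect \<phi> ^ n \<le> exp (- (c / real N * real (block_distance T))) ^ n"
      by (intro power_mono expect_nonneg) (auto simp: \<phi>_def)
    also have "\<dots> = y ^ block_distance T" by (simp add: y_def mult_ac flip: exp_of_nat_mult)
    finally have "expect \<phi> ^ n \<le> y ^ block_distance T" .
    moreover have "1 * sample_prob n (\<lambda>xs. True \<and> sample_score N xs S \<le> sample_score N xs T) \<le> expect \<phi> ^ n"
      unfolding \<phi>_def using score_fail_exp[of _ n T "rate / 2"] rate_nonneg by (intro chernoff) auto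
    moreover have "0 \<le> y ^ block_distance T" using y by simp
    ultimately show "sample_prob n (\<lambda>xs. True \<and> sample_score N xs S \<le> sample_score N xs T) \<le> 2 * y ^ block_distance T" by linarith
  qed
qed

end

section \<open>Recovery when the block contrast is rarely small\<close>

context block_spin
begin

lemma prod_exp_samples: "(\<Prod>k<n. exp (h (xs ! k))) = exp (\<Sum>k<n. h (xs ! k) :: real)"
  by (simp add: exp_sum)

text \<open>Let k be the block distance of T. The doubly discordant edges, summed over the samples,
  number at least 2ckn, up to a rare event. The good event leaves at most cn samples of small
  contrast, each wasting at most k edges. At least ckn edges remain in samples of large contrast,
  and each of them lowers the probability of a score failure by a factor exp(-\<theta>).\<close>

lemma recovery_critical:
  fixes \<theta> x :: real
  defines "c \<equiv> (1 - exp (- 1)) / (3 * energy_const)"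
  assumes \<delta>: "0 < \<delta>" "\<delta> < 1" and x: "0 \<le> x" and th: "0 \<le> \<theta>" "\<theta> \<le> 1" "exp (2 * \<theta>) \<le> cosh (4 * rate * x)"
    and small: "expect (\<lambda>\<sigma>. of_bool (\<bar>block_contrast N S \<sigma>\<bar> < 2 * x)) \<le> c / 4"
    and n: "12 * ln (real N / \<delta>) \<le> \<theta> * c * real n"
  shows "1 - \<delta> \<le> recovery_prob N \<alpha> \<beta> S n best_half"
proof -
  have c0: "0 < c" by (simp add: c_def)
  have c3: "(1 - exp (- 1)) / energy_const = 3 * c" by (simp add: c_def field_simps)
  have "1 \<le> energy_const"
    unfolding energy_const_def by (intro one_le_power) simp
  then have "(1 - exp (- 1)) / energy_const \<le> (1 - exp (- 1)) / 1" by (intro divide_left_mono) auto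
  also have "\<dots> \<le> 1" by simp
  finally have c1: "0 \<le> 1 - 3 * c" using c3 by simp
  have N2: "2 \<le> real N" using N_even N_pos by (auto elim!: evenE)
  have ln0: "0 \<le> ln (real N / \<delta>)" using \<delta> N2 by (intro ln_ge_zero) (simp add: field_simps)
  have "\<theta> * (c * real n) \<le> 1 * (c * real n)" using th c0 by (intro mult_right_mono) auto
  then have cn: "12 * ln (real N / \<delta>) \<le> c * real n" and thc: "\<theta> * c * real n \<le> c * real n" using n by (auto simp: mult_ac)
  let ?small = "\<lambda>\<sigma>. \<bar>block_contrast N S \<sigma>\<bar> < 2 * x"
  define G where "G xs \<longleftrightarrow> (\<Sum>k<n. of_bool (?small (xs ! k))) \<le> c * real n" for xs
  define y where "y = exp (- (\<theta> * c * real n))"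
  have y: "0 \<le> y" "y \<le> exp (- 12 * ln (real N / \<delta>))" using n by (simp_all add: y_def)
  show ?thesis
  proof (rule recovery_from_distance_bound[OF \<delta> y, where G=G])
    have one: "expect (\<lambda>_. 1) = 1" using partition_pos by (simp add: expect_eq)
    have "expect (\<lambda>\<sigma>. exp (of_bool (?small \<sigma>))) = expect (\<lambda>\<sigma>. 1 + (exp 1 - 1) * of_bool (?small \<sigma>))"
      unfolding expect_def by (intro sum.cong) auto
    also have "\<dots> = expect (\<lambda>_. 1) + (exp 1 - 1) * expect (\<lambda>\<sigma>. of_bool (?small \<sigma>))"
      unfolding expect_def by (simp add: distrib_left sum.distrib sum_distrib_left mult_ac)
    \<comment> \<open>Here exp 1 - 1 is at most 2. The mean fraction c/4 against the threshold c
      leaves exp(-cn/2), which is below \<delta>/N.\<close>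
    also have "\<dots> \<le> 1 + 2 * (c / 4)"
      unfolding one using small e_less_272
      by (intro add_left_mono mult_mono expect_nonneg) (auto intro: expect_nonneg)
    also have "\<dots> \<le> exp (c / 2)" using exp_ge_add_one_self[of "c / 2"] by simp
    finally have "expect (\<lambda>\<sigma>. exp (of_bool (?small \<sigma>))) ^ n \<le> exp (c / 2) ^ n"
      by (intro power_mono expect_nonneg) auto
    moreover have "exp (c * real n) * sample_prob n (\<lambda>xs. \<not> G xs) \<le> expect (\<lambda>\<sigma>. exp (of_bool (?small \<sigma>))) ^ n"
    proof (rule chernoff)
      fix xs assume "\<not> G xs"
      then show "exp (c * real n) \<le> (\<Prod>k<n. exp (of_bool (?small (xs ! k))))"
        unfolding G_def prod_exp_samples[of "\<lambda>\<sigma>. of_bool (?small \<sigma>)"] not_le exp_le_cancel_iff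
        by (rule less_imp_le)
    qed simp
    ultimately have "exp (c * real n) * sample_prob n (\<lambda>xs. \<not> G xs) \<le> exp (c * real n / 2)"
      by (simp add: mult_ac flip: exp_of_nat_mult)
    then have "sample_prob n (\<lambda>xs. \<not> G xs) \<le> exp (c * real n / 2) / exp (c * real n)"
      by (simp add: field_simps)
    also have "\<dots> = exp (- (c * real n / 2))" by (simp add: exp_diff[symmetric])
    also have "\<dots> \<le> exp (- ln (real N / \<delta>))" using cn ln0 by simp
    also have "\<dots> = \<delta> / real N" using \<delta> N2 by (simp add: exp_minus)
    also have "\<dots> \<le> \<delta> / 2" using \<delta> N2 by (intro divide_left_mono) auto
    finally show "sample_prob n (\<lambda>xs. \<not> G xs) \<le> \<delta> / 2" .
  next
    fix T assume T: "T \<in> wrong_halves"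
    then obtain \<pi> K where mp: "matched_pairing \<alpha> \<beta> N S T \<pi> K" and K: "card K = block_distance T"
      using obtain_matched_pairing[of T] by (metis DiffD1)
    interpret matched_pairing \<alpha> \<beta> N S T \<pi> K by (rule mp)
    let ?r = "\<lambda>\<sigma>. real (both_discordant \<sigma>)"
    define k where "k = block_distance T"
    define Q1 where "Q1 xs \<longleftrightarrow> (\<Sum>j<n. ?r (xs ! j)) < 2 * c * real k * real n" for xs
    define Q2 where "Q2 xs \<longleftrightarrow> sample_score N xs S \<le> sample_score N xs T \<and>
      c * real k * real n \<le> (\<Sum>j<n. ?r (xs ! j) * of_bool (2 * x \<le> \<bar>block_contrast N S (xs ! j)\<bar>))" for xs
    have "sample_prob n (\<lambda>xs. G xs \<and> sample_score N xs S \<le> sample_score N xs T) \<le> sample_prob n Q1 + sample_prob n Q2"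
    proof (rule sample_prob_disj)
      fix xs assume "xs \<in> samples N n" and g: "G xs \<and> sample_score N xs S \<le> sample_score N xs T"
      have "(\<Sum>j<n. ?r (xs ! j)) \<le> (\<Sum>j<n. ?r (xs ! j) * of_bool (2 * x \<le> \<bar>block_contrast N S (xs ! j)\<bar>)
          + real k * of_bool (?small (xs ! j)))"
        using both_discordant_le(3) K by (intro sum_mono) (auto simp: k_def not_less)
      also have "\<dots> = (\<Sum>j<n. ?r (xs ! j) * of_bool (2 * x \<le> \<bar>block_contrast N S (xs ! j)\<bar>))
          + real k * (\<Sum>j<n. of_bool (?small (xs ! j)))"
        by (simp only: sum.distrib sum_distrib_left)
      also have "real k * (\<Sum>j<n. of_bool (?small (xs ! j))) \<le> real k * (c * real n)"
        using g unfolding G_def by (intro mult_left_mono) auto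
      finally show "Q1 xs \<or> Q2 xs" using g unfolding Q1_def Q2_def by (simp add: mult_ac) linarith
    qed
    \<comment> \<open>The edge count has exponential rate 3c against the threshold 2c; as \<theta>
      is at most 1, the resulting exp(-ckn) is at most y^k.\<close>
    moreover have "sample_prob n Q1 \<le> y ^ k"
    proof -
      have "expect (\<lambda>\<sigma>. exp (- ?r \<sigma>)) \<le> (1 - 3 * c) ^ k"
        using both_discordant_exp unfolding c3 K k_def by (rule expect_le)
      also have "\<dots> \<le> exp (- (3 * c)) ^ k"
        using c1 exp_ge_add_one_self[of "- (3 * c)"] by (intro power_mono) auto
      finally have "expect (\<lambda>\<sigma>. exp (- ?r \<sigma>)) ^ n \<le> (exp (- (3 * c)) ^ k) ^ n"
        by (intro power_mono expect_nonneg) auto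
      also have "\<dots> = exp (- (3 * c * real k * real n))" by (simp add: mult_ac flip: exp_of_nat_mult)
      finally have "exp (- (2 * c * real k * real n)) * sample_prob n Q1 \<le> exp (- (3 * c * real k * real n))"
      proof (rule order.trans[rotated], intro chernoff)
        fix xs assume "Q1 xs"
        then show "exp (- (2 * c * real k * real n)) \<le> (\<Prod>j<n. exp (- ?r (xs ! j)))"
          unfolding Q1_def prod_exp_samples[of "\<lambda>\<sigma>. - ?r \<sigma>"] sum_negf by simp
      qed simp
      then have "sample_prob n Q1 \<le> exp (- (3 * c * real k * real n)) / exp (- (2 * c * real k * real n))"
        by (simp add: field_simps)
      also have "\<dots> = exp (- (real k * (c * real n)))" by (simp add: exp_diff[symmetric])
      also have "\<dots> \<le> exp (- (real k * (\<theta> * c * real n)))" using thc by (simp add: mult_left_mono)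
      also have "\<dots> = y ^ k" by (simp add: y_def flip: exp_of_nat_mult)
      finally show ?thesis .
    qed
    \<comment> \<open>On Q2 the product of the tilts is at least 1 and that of the bonuses at least
      exp(\<theta> c k n), the inverse of y^k, while their joint mean is at most 1.\<close>
    moreover have "sample_prob n Q2 \<le> y ^ k"
    proof -
      let ?b = "\<lambda>\<sigma>. \<theta> * ?r \<sigma> * of_bool (2 * x \<le> \<bar>block_contrast N S \<sigma>\<bar>)"
      let ?t = "\<lambda>\<sigma>. rate / 2 * ((block_contrast N T \<sigma>)\<^sup>2 - (block_contrast N S \<sigma>)\<^sup>2)"
      have "expect (\<lambda>\<sigma>. exp (?t \<sigma>) * exp (?b \<sigma>)) \<le> 1"
        using tilted_critical[OF x th(1,3)] by (intro expect_le) simp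
      then have "expect (\<lambda>\<sigma>. exp (?t \<sigma>) * exp (?b \<sigma>)) ^ n \<le> 1"
        by (intro power_le_one expect_nonneg) auto
      moreover have "exp (\<theta> * (c * real k * real n)) * sample_prob n Q2 \<le> expect (\<lambda>\<sigma>. exp (?t \<sigma>) * exp (?b \<sigma>)) ^ n"
      proof (rule chernoff)
        fix xs assume xs: "xs \<in> samples N n" and q: "Q2 xs"
        have "exp (\<theta> * (c * real k * real n)) \<le> exp (\<theta> * (\<Sum>j<n. ?r (xs ! j) * of_bool (2 * x \<le> \<bar>block_contrast N S (xs ! j)\<bar>)))"
          using q th(1) unfolding Q2_def by (simp add: mult_left_mono)
        also have "\<dots> = (\<Prod>j<n. exp (?b (xs ! j)))"
          unfolding prod_exp_samples[of ?b] sum_distrib_left by (simp only: mult.assoc)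
        finally have 1: "exp (\<theta> * (c * real k * real n)) \<le> (\<Prod>j<n. exp (?b (xs ! j)))" .
        have 2: "1 \<le> (\<Prod>j<n. exp (?t (xs ! j)))"
          using score_fail_exp[OF xs, of T "rate / 2"] q rate_nonneg by (simp add: Q2_def)
        have "1 * exp (\<theta> * (c * real k * real n)) \<le> (\<Prod>j<n. exp (?t (xs ! j))) * (\<Prod>j<n. exp (?b (xs ! j)))"
          by (intro mult_mono 1 2 prod_nonneg) auto
        then show "exp (\<theta> * (c * real k * real n)) \<le> (\<Prod>j<n. exp (?t (xs ! j)) * exp (?b (xs ! j)))"
          by (simp only: prod.distrib mult_1)
      qed auto
      ultimately have "exp (\<theta> * (c * real k * real n)) * sample_prob n Q2 \<le> 1" by linarith
      then have "sample_prob n Q2 \<le> 1 / exp (\<theta> * (c * real k * real n))" by (simp add: field_simps)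
      also have "\<dots> = y ^ k" by (simp add: y_def exp_minus inverse_eq_divide power_divide mult_ac flip: exp_of_nat_mult)
      finally show ?thesis .
    qed
    ultimately show "sample_prob n (\<lambda>xs. G xs \<and> sample_score N xs S \<le> sample_score N xs T) \<le> 2 * y ^ block_distance T"
      unfolding k_def by linarith
  qed
qed

end

section \<open>Anticoncentration at criticality\<close>

text \<open>The denominator \<open>M + 1\<close> instead of \<open>M\<close> makes the sequence exactly unimodal.\<close>
definition tilted_binomial :: "nat \<Rightarrow> nat \<Rightarrow> real" where
  "tilted_binomial M i = real (M choose i) * exp ((2 * real i - real M)\<^sup>2 / (2 * (real M + 1)))"

lemma tilted_binomial_pos: "i \<le> M \<Longrightarrow> 0 < tilted_binomial M i"
  by (simp add: tilted_binomial_def zero_less_binomial)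

lemma tilted_binomial_nonneg: "0 \<le> tilted_binomial M i"
  by (simp add: tilted_binomial_def)

lemma tilted_binomial_sym: "i \<le> M \<Longrightarrow> tilted_binomial M (M - i) = tilted_binomial M i"
  by (simp add: tilted_binomial_def binomial_symmetric[symmetric] of_nat_diff power2_eq_square algebra_simps)

text \<open>With v the rescaled midpoint of the step, the binomial ratio is exactly (1 - v) / (1 +
  v) and the Gaussian exponent grows by exactly 2v. Their logarithms cancel to first order, which is
  criticality.\<close>

lemma tilted_binomial_Suc:
  assumes "i < M"
  defines "v \<equiv> (2 * real i + 1 - real M) / (real M + 1)"
  shows "tilted_binomial M (Suc i) = tilted_binomial M i * ((1 - v) / (1 + v) * exp (2 * v))"
proof -
  have ch: "real (M choose Suc i) = real (M choose i) * ((real M - real i) / (real i + 1))"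
  proof -
    have "Suc i * (M choose Suc i) = (M - i) * (M choose i)"
      using binomial_absorb_comp[of M i] binomial_absorption[of i M] by simp
    then have "real (Suc i) * real (M choose Suc i) = real (M - i) * real (M choose i)"
      by (metis of_nat_mult)
    then show ?thesis using assms(1) by (simp add: of_nat_diff field_simps)
  qed
  have r: "(1 - v) / (1 + v) = (real M - real i) / (real i + 1)"
  proof -
    have "1 - v = 2 * (real M - real i) / (real M + 1)" "1 + v = 2 * (real i + 1) / (real M + 1)"
      by (simp_all add: v_def field_simps)
    then have "(1 - v) / (1 + v) = (2 * (real M - real i)) / (2 * (real i + 1))" by simp
    then show ?thesis by (subst (asm) mult_divide_mult_cancel_left) auto
  qed
  have e: "(2 * real (Suc i) - real M)\<^sup>2 / (2 * (real M + 1)) = (2 * real i - real M)\<^sup>2 / (2 * (real M + 1)) + 2 * v"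
  proof -
    have "(2 * real (Suc i) - real M)\<^sup>2 = (2 * real i - real M)\<^sup>2 + 2 * (2 * (2 * real i + 1 - real M))"
      by (simp add: power2_eq_square algebra_simps)
    then show ?thesis unfolding v_def
      by (simp only: add_divide_distrib mult_divide_mult_cancel_left_if) simp
  qed
  show ?thesis unfolding tilted_binomial_def e ch r exp_add by (simp add: mult_ac)
qed

text \<open>The logarithm F of the ratio has derivative -2v^2 / (1 - v^2), so it lies between -v^3
  and 0. A cubic loss per step means a quartic loss in total, the source of the scale 3/4.\<close>

lemma ratio_bounds:
  fixes v :: real
  shows "0 \<le> v \<Longrightarrow> v < 1 \<Longrightarrow> (1 - v) / (1 + v) * exp (2 * v) \<le> 1"
    and "0 \<le> v \<Longrightarrow> v \<le> 1 / 2 \<Longrightarrow> exp (- (v ^ 3)) \<le> (1 - v) / (1 + v) * exp (2 * v)"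
proof -
  define F where "F = (\<lambda>v::real. ln (1 - v) - ln (1 + v) + 2 * v)"
  have F0: "F 0 = 0" by (simp add: F_def)
  have FD: "(F has_real_derivative - (2 * v\<^sup>2 / (1 - v\<^sup>2))) (at v)" if "0 \<le> v" "v < 1" for v
  proof -
    have s: "0 < 1 - v\<^sup>2" using that by (simp add: power_less_one_iff abs_square_less_1)
    have "(F has_real_derivative - 1 / (1 - v) - 1 / (1 + v) + 2) (at v)"
      unfolding F_def using that by (auto intro!: derivative_eq_intros)
    moreover have "- 1 / (1 - v) - 1 / (1 + v) + 2 = - (2 * v\<^sup>2 / (1 - v\<^sup>2))"
    proof -
      have "1 - v\<^sup>2 = (1 - v) * (1 + v)" by (simp add: power2_eq_square algebra_simps)
      then show ?thesis using that s by (simp add: divide_simps)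
    qed
    ultimately show ?thesis by simp
  qed
  have ex: "(1 - v) / (1 + v) * exp (2 * v) = exp (F v)" if "0 \<le> v" "v < 1" for v
    using that by (simp add: F_def exp_add exp_diff)
  show "(1 - v) / (1 + v) * exp (2 * v) \<le> 1" if "0 \<le> v" "v < 1"
  proof -
    have "F v \<le> F 0"
    proof (rule DERIV_nonpos_imp_nonincreasing[OF that(1)])
      fix x assume x: "0 \<le> x" "x \<le> v"
      then have "0 < 1 - x\<^sup>2" using that by (simp add: abs_square_less_1)
      then have "- (2 * x\<^sup>2 / (1 - x\<^sup>2)) \<le> 0" by simp
      then show "\<exists>y. (F has_real_derivative y) (at x) \<and> y \<le> 0" using FD[of x] x that by fastforce
    qed
    then show ?thesis using ex[OF that] F0 by simp
  qed
  show "exp (- (v ^ 3)) \<le> (1 - v) / (1 + v) * exp (2 * v)" if "0 \<le> v" "v \<le> 1 / 2"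
  proof -
    have "(\<lambda>x. F x + x ^ 3) 0 \<le> (\<lambda>x. F x + x ^ 3) v"
    proof (rule DERIV_nonneg_imp_nondecreasing[OF that(1)])
      fix x assume x: "0 \<le> x" "x \<le> v"
      \<comment> \<open>Then 1 / (1 - x^2) is at most 4/3, and 8/3 is below 3.\<close>
      have x2: "x\<^sup>2 \<le> 1 / 4" using power_mono[of x "1 / 2" 2] x that by (simp add: power2_eq_square)
      have "2 * x\<^sup>2 / (1 - x\<^sup>2) \<le> 3 * x\<^sup>2"
      proof -
        have "2 * x\<^sup>2 \<le> 3 * x\<^sup>2 * (1 - x\<^sup>2)"
        proof -
          have "x\<^sup>2 * x\<^sup>2 \<le> x\<^sup>2 * (1 / 4)" using x2 by (intro mult_left_mono) auto
          then have "3 * (x\<^sup>2 * x\<^sup>2) \<le> x\<^sup>2" using zero_le_power2[of x] by linarith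
          then show ?thesis by (simp only: right_diff_distrib mult.assoc mult_1_right)
        qed
        then show ?thesis using x2 by (simp add: divide_le_eq)
      qed
      moreover have "((\<lambda>x. F x + x ^ 3) has_real_derivative - (2 * x\<^sup>2 / (1 - x\<^sup>2)) + 3 * x\<^sup>2) (at x)"
        using FD[of x] x that by (auto intro!: derivative_eq_intros)
      ultimately show "\<exists>y. ((\<lambda>x. F x + x ^ 3) has_real_derivative y) (at x) \<and> 0 \<le> y" by fastforce
    qed
    then have "- (v ^ 3) \<le> F v" using F0 by simp
    then show ?thesis using ex[of v] that by simp
  qed
qed

text \<open>Rounding M/2 up makes v nonnegative at each upward step from the centre, for either
  parity of M; the lower half follows by symmetry.\<close>

lemma tilted_binomial_le_center:
  assumes "i \<le> M" shows "tilted_binomial M i \<le> tilted_binomial M ((M + 1) div 2)"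
proof -
  define m0 where "m0 = (M + 1) div 2"
  have m0: "M \<le> 2 * m0" "2 * m0 \<le> M + 1" by (auto simp: m0_def)
  have up: "tilted_binomial M (m0 + k) \<le> tilted_binomial M m0" if "m0 + k \<le> M" for k
    using that
  proof (induction k)
    case (Suc k)
    define v where "v = (2 * real (m0 + k) + 1 - real M) / (real M + 1)"
    have "real M \<le> 2 * real m0" "real (m0 + k) + 1 \<le> real M" using m0(1) Suc.prems by linarith+
    then have v: "0 \<le> v" "v < 1" by (auto simp: v_def field_simps)
    have "tilted_binomial M (m0 + Suc k) = tilted_binomial M (m0 + k) * ((1 - v) / (1 + v) * exp (2 * v))"
      using tilted_binomial_Suc[of "m0 + k" M] Suc.prems by (simp add: v_def)
    also have "\<dots> \<le> tilted_binomial M (m0 + k) * 1"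
      by (intro mult_left_mono ratio_bounds(1) v tilted_binomial_nonneg)
    finally show ?case using Suc by simp
  qed simp
  show ?thesis
  proof (cases "m0 \<le> i")
    case True then show ?thesis using up[of "i - m0"] assms by (simp add: m0_def)
  next
    case False
    then have "m0 \<le> M - i" using m0 by linarith
    then have "m0 + (M - i - m0) = M - i" by simp
    then show ?thesis using up[of "M - i - m0"] tilted_binomial_sym[OF assms] unfolding m0_def[symmetric] by simp
  qed
qed

text \<open>Each of the k steps has v at most V = 2k / (M + 1) and loses at most V^3 in the
  exponent, in total k V^3. The second hypothesis says that V is at most 1/2.\<close>

lemma tilted_binomial_ge_center:
  assumes "(M + 1) div 2 + k \<le> M" "4 * real k \<le> real M + 1"
  shows "tilted_binomial M ((M + 1) div 2) * exp (- (8 * real k ^ 4 / (real M + 1) ^ 3)) \<le> tilted_binomial M ((M + 1) div 2 + k)"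
proof -
  define m0 where "m0 = (M + 1) div 2"
  have m0: "M \<le> 2 * m0" "2 * m0 \<le> M + 1" by (auto simp: m0_def)
  define V where "V = 2 * real k / (real M + 1)"
  have V: "0 \<le> V" "V \<le> 1 / 2" using assms(2) by (auto simp: V_def field_simps)
  have "tilted_binomial M m0 * exp (- (V ^ 3)) ^ j \<le> tilted_binomial M (m0 + j)" if "j \<le> k" for j
    using that
  proof (induction j)
    case (Suc j)
    define v where "v = (2 * real (m0 + j) + 1 - real M) / (real M + 1)"
    have "real M \<le> 2 * real m0" "2 * real m0 \<le> real M + 1" "real j + 1 \<le> real k"
      using m0 Suc.prems by linarith+
    then have v: "0 \<le> v" "v \<le> V" by (auto simp: v_def V_def intro!: divide_right_mono)
    have "tilted_binomial M m0 * exp (- (V ^ 3)) ^ Suc j = tilted_binomial M m0 * exp (- (V ^ 3)) ^ j * exp (- (V ^ 3))"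
      by simp
    also have "\<dots> \<le> tilted_binomial M (m0 + j) * ((1 - v) / (1 + v) * exp (2 * v))"
    proof (intro mult_mono)
      have "exp (- (V ^ 3)) \<le> exp (- (v ^ 3))" using v by (simp add: power_mono)
      also have "\<dots> \<le> (1 - v) / (1 + v) * exp (2 * v)" using v V by (intro ratio_bounds(2)) auto
      finally show "exp (- (V ^ 3)) \<le> (1 - v) / (1 + v) * exp (2 * v)" .
    qed (use Suc tilted_binomial_nonneg in auto)
    also have "\<dots> = tilted_binomial M (m0 + Suc j)"
      using tilted_binomial_Suc[of "m0 + j" M] Suc.prems assms(1) by (simp add: v_def m0_def)
    finally show ?case .
  qed simp
  from this[of k] have "tilted_binomial M m0 * exp (- (V ^ 3)) ^ k \<le> tilted_binomial M (m0 + k)" by simp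
  moreover have "exp (- (V ^ 3)) ^ k = exp (- (8 * real k ^ 4 / (real M + 1) ^ 3))"
    by (simp add: V_def power_divide power_mult_distrib flip: exp_of_nat_mult) (simp add: power_eq_if)
  ultimately show ?thesis by (simp add: m0_def)
qed

lemma sum_Pow_card:
  fixes H :: "nat \<Rightarrow> real"
  assumes "finite A" shows "(\<Sum>B\<in>Pow A. H (card B)) = (\<Sum>a\<le>card A. real (card A choose a) * H a)"
proof -
  have "(\<Sum>B\<in>Pow A. H (card B)) = (\<Sum>a\<le>card A. \<Sum>B\<in>{B \<in> Pow A. card B = a}. H (card B))"
    using assms by (intro sum.group[symmetric]) (auto intro: card_mono)
  also have "\<dots> = (\<Sum>a\<le>card A. real (card A choose a) * H a)"
    using n_subsets[OF assms] by (intro sum.cong) auto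
  finally show ?thesis .
qed

text \<open>With R = sqrt M, the tangent bound t^2 / M >= 2t/R - 1 replaces the Gaussian by a
  geometric series of ratio exp(-2c/R), whose sum is at most R / (2c).\<close>

lemma gauss_sum_bound:
  assumes c: "0 < c" and M: "1 \<le> M"
  shows "(\<Sum>t\<in>{- int M..int M}. exp (- (c * (real_of_int t)\<^sup>2 / real M))) \<le> (1 + exp c / c) * sqrt (real M)"
proof -
  define R where "R = sqrt (real M)"
  have R: "1 \<le> R" "R\<^sup>2 = real M" using M by (auto simp: R_def)
  define q where "q = exp (- (2 * c / R))"
  have q: "0 < q" "q < 1" using c R by (auto simp: q_def)
  let ?g = "\<lambda>t::int. exp (- (c * (real_of_int t)\<^sup>2 / real M))"
  have pos: "?g (int t) \<le> exp c * q ^ t" for t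
  proof -
    have "0 \<le> (real t / R - 1)\<^sup>2" by simp
    then have "2 * (real t / R) - 1 \<le> (real t)\<^sup>2 / real M" using R by (simp add: power2_diff power_divide)
    then have "c * (2 * (real t / R) - 1) \<le> c * ((real t)\<^sup>2 / real M)" using c by (intro mult_left_mono) auto
    then have "?g (int t) \<le> exp (c + real t * (- (2 * c / R)))" by (simp add: algebra_simps)
    also have "\<dots> = exp c * q ^ t" by (simp only: exp_add exp_of_nat_mult q_def)
    finally show ?thesis .
  qed
  have geo: "(\<Sum>t\<in>{1..M}. ?g (int t)) \<le> exp c * (R / (2 * c))"
  proof -
    have "(\<Sum>t\<in>{1..M}. ?g (int t)) \<le> (\<Sum>t\<in>{1..M}. exp c * q ^ t)" by (intro sum_mono pos)
    also have "\<dots> = exp c * (\<Sum>t<M. q ^ Suc t)"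
      by (simp only: sum_distrib_left[symmetric] atLeast0LessThan[symmetric] sum.shift_bounds_Suc_ivl[symmetric])
        (simp add: atLeastLessThanSuc_atLeastAtMost)
    also have "(\<Sum>t<M. q ^ Suc t) = q * ((1 - q ^ M) / (1 - q))"
      using q by (simp add: sum_distrib_left[symmetric] sum_gp_strict)
    also have "\<dots> \<le> q * (1 / (1 - q))" using q by (intro mult_left_mono divide_right_mono) auto
    also have "\<dots> \<le> R / (2 * c)"
    proof -
      have "1 + 2 * c / R \<le> exp (2 * c / R)" by (rule exp_ge_add_one_self)
      also have "\<dots> = 1 / q" by (simp add: q_def exp_minus inverse_eq_divide)
      finally have "2 * c / R \<le> (1 - q) / q" using q by (simp add: diff_divide_distrib)
      then have "2 * c * q \<le> R * (1 - q)" using q R by (simp add: field_simps)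
      then show ?thesis using q c by (simp add: field_simps)
    qed
    finally show ?thesis by simp
  qed
  have "{- int M..int M} = insert 0 (int ` {1..M} \<union> (\<lambda>t. - int t) ` {1..M})"
  proof (intro set_eqI iffI)
    fix t assume "t \<in> {- int M..int M}"
    then have "t = 0 \<or> t = int (nat t) \<and> nat t \<in> {1..M} \<or> t = - int (nat (- t)) \<and> nat (- t) \<in> {1..M}" by auto
    then show "t \<in> insert 0 (int ` {1..M} \<union> (\<lambda>t. - int t) ` {1..M})" by blast
  qed auto
  then have "(\<Sum>t\<in>{- int M..int M}. ?g t) = ?g 0 + ((\<Sum>t\<in>int ` {1..M}. ?g t) + (\<Sum>t\<in>(\<lambda>t. - int t) ` {1..M}. ?g t))"
    by (simp only:) (subst sum.insert, simp, force, subst sum.union_disjoint, auto)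
  also have "(\<Sum>t\<in>(\<lambda>t. - int t) ` {1..M}. ?g t) = (\<Sum>t\<in>{1..M}. ?g (int t))"
    by (subst sum.reindex) (auto simp: inj_on_def)
  also have "(\<Sum>t\<in>int ` {1..M}. ?g t) = (\<Sum>t\<in>{1..M}. ?g (int t))"
    by (subst sum.reindex) (auto simp: inj_on_def)
  also have "?g 0 + ((\<Sum>t\<in>{1..M}. ?g (int t)) + (\<Sum>t\<in>{1..M}. ?g (int t))) \<le> R + 2 * (exp c * (R / (2 * c)))"
    unfolding mult_2[symmetric] using geo R by (intro add_mono mult_left_mono) simp_all
  also have "\<dots> = (1 + exp c / c) * R" using c by (simp add: field_simps)
  finally show ?thesis by (simp add: R_def)
qed

text \<open>Weight of one block of size m with \<open>a\<close> plus spins in the critical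
  Curie-Weiss model; unlike \<open>tilted_binomial\<close> it has the true denominator.\<close>

definition critical_binomial :: "nat \<Rightarrow> nat \<Rightarrow> real" where
  "critical_binomial m a = real (m choose a) * exp ((2 * real a - real m)\<^sup>2 / (2 * real m))"

text \<open>Joint weight of the plus counts \<open>a\<close> and \<open>b\<close> in the two blocks,
  to be used with c = -\<alpha>; a + b - m is half the magnetization.\<close>

definition count_weight :: "real \<Rightarrow> nat \<Rightarrow> nat \<Rightarrow> nat \<Rightarrow> real" where
  "count_weight c m a b = critical_binomial m a * critical_binomial m b
     * exp (- (c * (real a + real b - real m)\<^sup>2 / real m))"

text \<open>The exponents differ by (2a - m)^2 / (2m (m + 1)), which is at most 1/2 because 2a - m
  has modulus at most m.\<close>

lemma critical_binomial_bounds: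
  assumes "1 \<le> m" "a \<le> m"
  shows "tilted_binomial m a \<le> critical_binomial m a" "critical_binomial m a \<le> exp (1 / 2) * tilted_binomial m a"
proof -
  let ?x = "(2 * real a - real m)\<^sup>2"
  have le: "?x / (2 * (real m + 1)) \<le> ?x / (2 * real m)" using assms by (intro divide_left_mono) auto
  then show "tilted_binomial m a \<le> critical_binomial m a"
    unfolding tilted_binomial_def critical_binomial_def by (intro mult_left_mono) auto
  have "\<bar>2 * real a - real m\<bar> \<le> real m" using assms by auto
  then have "?x \<le> (real m)\<^sup>2" by (metis abs_le_square_iff abs_of_nat)
  then have "?x \<le> real m * (real m + 1)" by (simp add: power2_eq_square algebra_simps)
  then have "?x / (real m * (real m + 1)) \<le> 1" using assms by (simp add: divide_le_eq)
  moreover have "?x / (2 * real m) - ?x / (2 * (real m + 1)) = ?x / (real m * (real m + 1)) / 2"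
    using assms by (simp add: divide_simps) (simp add: algebra_simps)
  ultimately have "?x / (2 * real m) - ?x / (2 * (real m + 1)) \<le> 1 / 2" by simp
  then have "exp (?x / (2 * real m)) \<le> exp (1 / 2 + ?x / (2 * (real m + 1)))" by simp
  then show "critical_binomial m a \<le> exp (1 / 2) * tilted_binomial m a"
    using mult_left_mono[of "exp (?x / (2 * real m))" _ "real (m choose a)"]
    unfolding tilted_binomial_def critical_binomial_def exp_add by (simp only: mult.left_commute of_nat_0_le_iff)
qed

lemma count_weight_nonneg: "0 \<le> count_weight c m a b"
  by (simp add: count_weight_def critical_binomial_def)

lemma card_int_abs_less:
  fixes x :: real
  assumes "0 \<le> x"
  shows "finite {s::int. \<bar>real_of_int s\<bar> < x}" "real (card {s::int. \<bar>real_of_int s\<bar> < x}) \<le> 2 * x + 1"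
proof -
  have sub: "{s::int. \<bar>real_of_int s\<bar> < x} \<subseteq> {- (\<lceil>x\<rceil> - 1)..\<lceil>x\<rceil> - 1}"
  proof
    fix s :: int assume "s \<in> {s. \<bar>real_of_int s\<bar> < x}"
    then have "real_of_int \<bar>s\<bar> < real_of_int \<lceil>x\<rceil>" using le_of_int_ceiling[of x] by (auto simp del: le_of_int_ceiling)
    then have "\<bar>s\<bar> < \<lceil>x\<rceil>" by simp
    then show "s \<in> {- (\<lceil>x\<rceil> - 1)..\<lceil>x\<rceil> - 1}" by auto
  qed
  then show "finite {s::int. \<bar>real_of_int s\<bar> < x}" by (rule finite_subset) simp
  have "card {s::int. \<bar>real_of_int s\<bar> < x} \<le> card {- (\<lceil>x\<rceil> - 1)..\<lceil>x\<rceil> - 1}" by (rule card_mono[OF _ sub]) simp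
  then have "real (card {s::int. \<bar>real_of_int s\<bar> < x}) \<le> real (nat (2 * \<lceil>x\<rceil> - 1))" by (simp add: algebra_simps)
  also have "\<dots> \<le> 2 * x + 1"
  proof (cases "0 \<le> 2 * \<lceil>x\<rceil> - 1")
    case True then show ?thesis using ceiling_correct[of x] by simp
  next
    case False then show ?thesis using assms by simp
  qed
  finally show "real (card {s::int. \<bar>real_of_int s\<bar> < x}) \<le> 2 * x + 1" .
qed

text \<open>The critical binomial weights are flat up to a constant factor on the scale \<open>m powr (3/4)\<close>,
  while the antiferromagnetic factor confines \<open>a + b - m\<close> to the scale \<open>sqrt m\<close>.\<close>
lemma count_weight_anticoncentration:
  assumes c: "0 < c" "c \<le> 1" and m: "2 \<le> m" and L: "0 < L" "L ^ 4 = real m ^ 3" "8 * L \<le> real m" "sqrt (real m) \<le> L"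
    and x: "0 \<le> x"
  shows "(\<Sum>a\<le>m. \<Sum>b\<le>m. count_weight c m a b * of_bool (\<bar>real a - real b\<bar> < x))
     \<le> exp 258 * (1 + exp c / c) * (2 * x + 1) / L * (\<Sum>a\<le>m. \<Sum>b\<le>m. count_weight c m a b)"
proof -
  define m0 where "m0 = (m + 1) div 2"
  define g where "g = tilted_binomial m m0"
  define \<Gamma> where "\<Gamma> = 1 + exp c / c"
  define h where "h t = exp (- (c * (real_of_int t)\<^sup>2 / real m))" for t :: int
  have g0: "0 < g" unfolding g_def m0_def using m by (intro tilted_binomial_pos) auto
  have \<Gamma>0: "0 < \<Gamma>" using c by (simp add: \<Gamma>_def add_pos_pos)
  let ?X = "{s::int. \<bar>real_of_int s\<bar> < x}" and ?T = "{- int m..int m}"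
  have "(\<Sum>a\<le>m. \<Sum>b\<le>m. count_weight c m a b * of_bool (\<bar>real a - real b\<bar> < x))
     = (\<Sum>(a, b)\<in>{..m} \<times> {..m}. count_weight c m a b * of_bool (\<bar>real a - real b\<bar> < x))"
    by (rule sum.cartesian_product)
  also have "\<dots> = (\<Sum>(a, b)\<in>{(a, b) \<in> {..m} \<times> {..m}. \<bar>real a - real b\<bar> < x}. count_weight c m a b)"
    by (rule sum.mono_neutral_cong_right) auto
  also have "\<dots> \<le> (\<Sum>(a, b)\<in>{(a, b) \<in> {..m} \<times> {..m}. \<bar>real a - real b\<bar> < x}. exp 1 * g\<^sup>2 * h (int a + int b - int m))"
  proof (rule sum_mono, clarsimp)
    fix a b assume ab: "a \<le> m" "b \<le> m"
    have cb: "critical_binomial m i \<le> exp (1 / 2) * g" if "i \<le> m" for i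
    proof -
      have "critical_binomial m i \<le> exp (1 / 2) * tilted_binomial m i" using critical_binomial_bounds(2)[of m i] that m by simp
      also have "\<dots> \<le> exp (1 / 2) * g" using tilted_binomial_le_center[OF that] by (simp add: g_def m0_def)
      finally show ?thesis .
    qed
    have "critical_binomial m a * critical_binomial m b \<le> (exp (1 / 2) * g) * (exp (1 / 2) * g)"
      using cb ab g0 by (intro mult_mono) (auto simp: critical_binomial_def)
    also have "\<dots> = (exp (1 / 2) * exp (1 / 2)) * g\<^sup>2" by (simp only: power2_eq_square mult_ac)
    also have "exp (1 / 2) * exp (1 / 2) = exp (1 :: real)" by (simp flip: exp_add)
    finally show "count_weight c m a b \<le> exp 1 * g\<^sup>2 * h (int a + int b - int m)"
      unfolding count_weight_def h_def by (auto intro!: mult_right_mono)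
  qed
  \<comment> \<open>In the coordinates s = a - b and t = a + b - m the bound depends on t only.
    Ignoring the parity relation between s and t enlarges the sum to a full product.\<close>
  also have "\<dots> = (\<Sum>p\<in>(\<lambda>(a, b). (int a - int b, int a + int b - int m)) `
      {(a, b) \<in> {..m} \<times> {..m}. \<bar>real a - real b\<bar> < x}. exp 1 * g\<^sup>2 * h (snd p))"
    by (subst sum.reindex) (auto simp: inj_on_def case_prod_beta)
  also have "\<dots> \<le> (\<Sum>p\<in>?X \<times> ?T. exp 1 * g\<^sup>2 * h (snd p))"
    by (intro sum_mono2) (auto simp: h_def card_int_abs_less(1)[OF x])
  also have "\<dots> = exp 1 * g\<^sup>2 * (real (card ?X) * (\<Sum>t\<in>?T. h t))"
  proof -
    have "(\<Sum>p\<in>?X \<times> ?T. exp 1 * g\<^sup>2 * h (snd p)) = (\<Sum>s\<in>?X. \<Sum>t\<in>?T. exp 1 * g\<^sup>2 * h t)"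
      by (subst sum.cartesian_product) (simp add: case_prod_beta)
    then show ?thesis by (simp flip: sum_distrib_left)
  qed
  also have "\<dots> \<le> exp 1 * g\<^sup>2 * ((2 * x + 1) * (\<Gamma> * sqrt (real m)))"
  proof -
    have "(\<Sum>t\<in>?T. h t) \<le> \<Gamma> * sqrt (real m)"
      unfolding h_def \<Gamma>_def using gauss_sum_bound[OF c(1), of m] m by simp
    then show ?thesis using card_int_abs_less(2)[OF x] x
      by (intro mult_left_mono mult_mono sum_nonneg) (auto simp: h_def)
  qed
  finally have upper: "(\<Sum>a\<le>m. \<Sum>b\<le>m. count_weight c m a b * of_bool (\<bar>real a - real b\<bar> < x))
    \<le> exp 1 * g\<^sup>2 * ((2 * x + 1) * (\<Gamma> * sqrt (real m)))" .

  \<comment> \<open>Lower bound for the normalisation: a = m0 + k and b = m - (m0 + k + t) give a +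
    b - m = -t, so k may range over the scale L while t stays within sqrt m.\<close>
  define K1 where "K1 = nat \<lfloor>L\<rfloor>"
  define K2 where "K2 = nat \<lfloor>sqrt (real m)\<rfloor>"
  have K1: "real K1 \<le> L" "L \<le> real (Suc K1)" using L(1) by (auto simp: K1_def) linarith+
  have K2: "real K2 \<le> sqrt (real m)" "sqrt (real m) \<le> real (Suc K2)" by (auto simp: K2_def) linarith+
  have mm: "2 * m0 \<le> m + 1" by (simp add: m0_def)
  have fits: "m0 + j \<le> m" "4 * real j \<le> real m + 1" "g * exp (- 128) \<le> critical_binomial m (m0 + j)" if "j \<le> K1 + K2" for j
  proof -
    have j: "real j \<le> 2 * L" using that K1 K2 L(4) by linarith
    then have "4 * real j \<le> real m" using L(3) by linarith
    then show j2: "4 * real j \<le> real m + 1" by simp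
    show j1: "m0 + j \<le> m" using \<open>4 * real j \<le> real m\<close> mm m by linarith
    \<comment> \<open>The offset is at most 2L, and L^4 = m^3 turns 8 (2L)^4 / m^3 into 128.\<close>
    have "8 * real j ^ 4 / (real m + 1) ^ 3 \<le> 8 * (2 * L) ^ 4 / real m ^ 3"
      using j m by (intro frac_le mult_left_mono power_mono) auto
    also have "\<dots> = 128" using m by (simp add: power_mult_distrib L(2))
    finally have "exp (- 128) \<le> exp (- (8 * real j ^ 4 / (real m + 1) ^ 3))" by simp
    then have "g * exp (- 128) \<le> g * exp (- (8 * real j ^ 4 / (real m + 1) ^ 3))" using g0 by (intro mult_left_mono) auto
    also have "\<dots> \<le> tilted_binomial m (m0 + j)"
      unfolding g_def m0_def using j1 j2 by (intro tilted_binomial_ge_center) (auto simp: m0_def)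
    also have "\<dots> \<le> critical_binomial m (m0 + j)" using j1 m by (intro critical_binomial_bounds(1)) auto
    finally show "g * exp (- 128) \<le> critical_binomial m (m0 + j)" .
  qed
  have cb_sym: "critical_binomial m (m - i) = critical_binomial m i" if "i \<le> m" for i
    using that by (simp add: critical_binomial_def binomial_symmetric[symmetric] of_nat_diff power2_eq_square algebra_simps)
  \<comment> \<open>257 = 128 + 128 + 1: one loss per block, and 1 from the antiferromagnetic
    factor. The exp 1 of the upper bound later makes it 258.\<close>
  have "L * sqrt (real m) * (exp (- 257) * g\<^sup>2) \<le> real (Suc K1) * real (Suc K2) * (exp (- 257) * g\<^sup>2)"
    using K1 K2 L(1) by (intro mult_right_mono mult_mono) auto
  also have "\<dots> = (\<Sum>(k, t)\<in>{..K1} \<times> {..K2}. exp (- 257) * g\<^sup>2)"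
    by (simp only: case_prod_conv sum_constant card_cartesian_product card_atMost of_nat_mult split_def)
  also have "\<dots> \<le> (\<Sum>(k, t)\<in>{..K1} \<times> {..K2}. count_weight c m (m0 + k) (m - (m0 + k + t)))"
  proof (rule sum_mono, clarsimp)
    fix k t assume kt: "k \<le> K1" "t \<le> K2"
    have k: "k \<le> K1 + K2" and kt': "k + t \<le> K1 + K2" using kt by auto
    have mag: "real (m0 + k) + real (m - (m0 + k + t)) - real m = - real t"
      using fits(1)[OF kt'] by (simp add: of_nat_diff)
    have "real t \<le> sqrt (real m)" using kt K2 by linarith
    then have "(real t)\<^sup>2 \<le> real m" using power_mono[of "real t" "sqrt (real m)" 2] by simp
    then have "c * (real t)\<^sup>2 \<le> 1 * real m" using c by (intro mult_mono) auto
    then have "c * (real t)\<^sup>2 / real m \<le> 1" using m by (simp add: divide_le_eq)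
    then have e: "exp (- 1) \<le> exp (- (c * (- real t)\<^sup>2 / real m))" by simp
    have b: "g * exp (- 128) \<le> critical_binomial m (m - (m0 + k + t))"
      using fits(3)[OF kt'] cb_sym[OF fits(1)[OF kt']] by (simp add: add.assoc)
    have "(g * exp (- 128)) * (g * exp (- 128)) * exp (- 1) \<le> count_weight c m (m0 + k) (m - (m0 + k + t))"
      unfolding count_weight_def mag using fits(3)[OF k] b e g0
      by (intro mult_mono mult_nonneg_nonneg) (simp_all add: critical_binomial_def)
    moreover have "(g * exp (- 128)) * (g * exp (- 128)) * exp (- 1) = exp (- 257) * g\<^sup>2"
    proof -
      have "exp (- 257) = exp (- 128) * exp (- 128) * exp (- 1 :: real)"
        unfolding exp_add[symmetric] by simp
      then show ?thesis by (simp only: power2_eq_square mult_ac)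
    qed
    ultimately show "exp (- 257) * g\<^sup>2 \<le> count_weight c m (m0 + k) (m - (m0 + k + t))" by simp
  qed
  also have "\<dots> = (\<Sum>(a, b)\<in>(\<lambda>(k, t). (m0 + k, m - (m0 + k + t))) ` ({..K1} \<times> {..K2}). count_weight c m a b)"
  proof -
    have "inj_on (\<lambda>(k, t). (m0 + k, m - (m0 + k + t))) ({..K1} \<times> {..K2})"
    proof (rule inj_onI, clarsimp)
      fix k t t' assume "k \<le> K1" "t \<le> K2" "t' \<le> K2" and eq: "m - (m0 + k + t) = m - (m0 + k + t')"
      then have "m0 + (k + t) \<le> m" "m0 + (k + t') \<le> m" using fits(1)[of "k + t"] fits(1)[of "k + t'"] by auto
      then show "t = t'" using eq by linarith
    qed
    then show ?thesis by (simp add: sum.reindex o_def split_def)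
  qed
  also have "\<dots> \<le> (\<Sum>(a, b)\<in>{..m} \<times> {..m}. count_weight c m a b)"
  proof (rule sum_mono2)
    show "(\<lambda>(k, t). (m0 + k, m - (m0 + k + t))) ` ({..K1} \<times> {..K2}) \<subseteq> {..m} \<times> {..m}"
    proof (rule image_subsetI)
      fix p assume "p \<in> {..K1} \<times> {..K2}"
      then have "fst p \<le> K1 + K2" by (simp add: mem_Times_iff)
      then show "(\<lambda>(k, t). (m0 + k, m - (m0 + k + t))) p \<in> {..m} \<times> {..m}"
        using fits(1)[of "fst p"] by (simp add: split_def)
    qed
  qed (simp_all add: split_def count_weight_nonneg)
  also have "\<dots> = (\<Sum>a\<le>m. \<Sum>b\<le>m. count_weight c m a b)" by (rule sum.cartesian_product[symmetric])
  finally have lower: "L * sqrt (real m) * (exp (- 257) * g\<^sup>2) \<le> (\<Sum>a\<le>m. \<Sum>b\<le>m. count_weight c m a b)" .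
  have "exp 1 * g\<^sup>2 * ((2 * x + 1) * (\<Gamma> * sqrt (real m)))
      = exp 258 * \<Gamma> * (2 * x + 1) / L * (L * sqrt (real m) * (exp (- 257) * g\<^sup>2))"
  proof -
    have e: "exp 1 = exp 258 * exp (- 257 :: real)" unfolding exp_add[symmetric] by simp
    have "A * B * g\<^sup>2 * ((2 * x + 1) * (\<Gamma> * sqrt (real m)))
        = A * \<Gamma> * (2 * x + 1) / L * (L * sqrt (real m) * (B * g\<^sup>2))" for A B
      using L(1) by simp
    then show ?thesis unfolding e .
  qed
  also have "\<dots> \<le> exp 258 * \<Gamma> * (2 * x + 1) / L * (\<Sum>a\<le>m. \<Sum>b\<le>m. count_weight c m a b)"
    using lower \<Gamma>0 x L(1) by (intro mult_left_mono) auto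
  finally show ?thesis using upper by (simp add: \<Gamma>_def)
qed

lemma sum_sign_indicator:
  assumes "finite X"
  shows "(\<Sum>i\<in>X. if i \<in> C then 1 else - 1) = 2 * real (card (X \<inter> C)) - real (card X)"
proof -
  have "(\<Sum>i\<in>X. if i \<in> C then 1 else - 1 :: real) = real (card (X \<inter> C)) - real (card (X - C))"
    using assms by (simp add: sum.If_cases Diff_eq Int_def)
  moreover have "card X = card (X \<inter> C) + card (X - C)" using assms by (rule card_Int_Diff)
  ultimately show ?thesis by simp
qed

section \<open>Law of the two block counts under the Gibbs measure\<close>

context block_spin
begin

lemma sum_spin_configs_counts:
  fixes F :: "real \<Rightarrow> real \<Rightarrow> real"
  defines "m \<equiv> N div 2"
  shows "(\<Sum>\<sigma>\<in>spin_configs N. F (magnetization N \<sigma>) (block_contrast N S \<sigma>))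
    = (\<Sum>a\<le>m. \<Sum>b\<le>m. real (m choose a) * real (m choose b)
        * F (2 * (real a + real b - real m)) (2 * (real a - real b)))"
proof -
  let ?S' = "{0..<N} - S"
  have cS: "card S = m" "card ?S' = m" "finite ?S'"
    using S_card S_sub finite_S N_even by (auto simp: m_def card_Diff_subset elim!: evenE)
  define cfg where "cfg C = (\<lambda>i. if i < N then (if i \<in> C then 1 else - 1 :: int) else undefined)" for C
  have split: "(\<Sum>i<N. G i) = (\<Sum>i\<in>S. G i) + (\<Sum>i\<in>?S'. G i)" for G :: "nat \<Rightarrow> real"
  proof -
    have "(\<Sum>i\<in>{0..<N}. G i) = (\<Sum>i\<in>?S'. G i) + (\<Sum>i\<in>S. G i)" using S_sub by (intro sum.subset_diff) auto
    then show ?thesis by (simp add: lessThan_atLeast0)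
  qed
  have blocks: "(\<Sum>i\<in>S. real_of_int (cfg (A \<union> B) i)) = 2 * real (card A) - real m"
    "(\<Sum>i\<in>?S'. real_of_int (cfg (A \<union> B) i)) = 2 * real (card B) - real m"
    if "A \<subseteq> S" "B \<subseteq> ?S'" for A B
  proof -
    have i: "S \<inter> (A \<union> B) = A" "?S' \<inter> (A \<union> B) = B" using that by auto
    have "(\<Sum>i\<in>X. real_of_int (cfg (A \<union> B) i)) = (\<Sum>i\<in>X. if i \<in> A \<union> B then 1 else - 1)" if "X \<subseteq> {0..<N}" for X
      using that by (intro sum.cong) (auto simp: cfg_def)
    from this[OF S_sub] this[of ?S']
    show "(\<Sum>i\<in>S. real_of_int (cfg (A \<union> B) i)) = 2 * real (card A) - real m"
      "(\<Sum>i\<in>?S'. real_of_int (cfg (A \<union> B) i)) = 2 * real (card B) - real m"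
      using sum_sign_indicator[OF finite_S, of "A \<union> B"] sum_sign_indicator[OF cS(3), of "A \<union> B"] unfolding i cS by auto
  qed
  have mag: "magnetization N (cfg (A \<union> B)) = 2 * (real (card A) + real (card B) - real m)" if "A \<subseteq> S" "B \<subseteq> ?S'" for A B
    unfolding magnetization_def split using blocks[OF that] by simp
  have con: "block_contrast N S (cfg (A \<union> B)) = 2 * (real (card A) - real (card B))" if "A \<subseteq> S" "B \<subseteq> ?S'" for A B
    unfolding block_contrast_def split using blocks[OF that] by (simp add: sum_negf)
  have "(\<Sum>\<sigma>\<in>spin_configs N. F (magnetization N \<sigma>) (block_contrast N S \<sigma>))
      = (\<Sum>(A, B)\<in>Pow S \<times> Pow ?S'. F (magnetization N (cfg (A \<union> B))) (block_contrast N S (cfg (A \<union> B))))"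
  proof (rule sum.reindex_bij_witness[where i="\<lambda>(A, B). cfg (A \<union> B)"
        and j="\<lambda>\<sigma>. ({i \<in> S. \<sigma> i = 1}, {i \<in> ?S'. \<sigma> i = 1})"])
    fix \<sigma> assume \<sigma>: "\<sigma> \<in> spin_configs N"
    have "cfg ({i \<in> S. \<sigma> i = 1} \<union> {i \<in> ?S'. \<sigma> i = 1}) i = \<sigma> i" for i
    proof (cases "i < N")
      case True
      then show ?thesis using spin_configs_values[OF \<sigma> True] by (auto simp: cfg_def)
    next
      case False
      then show ?thesis using \<sigma> by (auto simp: cfg_def spin_configs_def PiE_def extensional_def)
    qed
    then have "cfg ({i \<in> S. \<sigma> i = 1} \<union> {i \<in> ?S'. \<sigma> i = 1}) = \<sigma>" by (rule ext)
    then show "(case ({i \<in> S. \<sigma> i = 1}, {i \<in> ?S'. \<sigma> i = 1}) of (A, B) \<Rightarrow> cfg (A \<union> B)) = \<sigma>"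
      "(case ({i \<in> S. \<sigma> i = 1}, {i \<in> ?S'. \<sigma> i = 1}) of (A, B) \<Rightarrow>
          F (magnetization N (cfg (A \<union> B))) (block_contrast N S (cfg (A \<union> B))))
        = F (magnetization N \<sigma>) (block_contrast N S \<sigma>)" by simp_all
    show "({i \<in> S. \<sigma> i = 1}, {i \<in> ?S'. \<sigma> i = 1}) \<in> Pow S \<times> Pow ?S'" by auto
  next
    fix p assume "p \<in> Pow S \<times> Pow ?S'"
    then obtain A B where p: "p = (A, B)" "A \<subseteq> S" "B \<subseteq> ?S'" by auto
    have "{i \<in> S. cfg (A \<union> B) i = 1} = A" "{i \<in> ?S'. cfg (A \<union> B) i = 1} = B"
      using p S_sub by (auto simp: cfg_def)
    then show "({i \<in> S. (case p of (A, B) \<Rightarrow> cfg (A \<union> B)) i = 1}, {i \<in> ?S'. (case p of (A, B) \<Rightarrow> cfg (A \<union> B)) i = 1}) = p"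
      using p by simp
    show "(case p of (A, B) \<Rightarrow> cfg (A \<union> B)) \<in> spin_configs N"
      unfolding p by (auto simp: cfg_def spin_configs_def PiE_def extensional_def)
  qed
  also have "\<dots> = (\<Sum>A\<in>Pow S. \<Sum>B\<in>Pow ?S'. F (2 * (real (card A) + real (card B) - real m)) (2 * (real (card A) - real (card B))))"
    unfolding sum.cartesian_product[symmetric] by (intro sum.cong refl) (simp add: mag con)
  also have "\<dots> = (\<Sum>A\<in>Pow S. \<Sum>b\<le>m. real (m choose b) * F (2 * (real (card A) + real b - real m)) (2 * (real (card A) - real b)))"
    using sum_Pow_card[OF cS(3)] unfolding cS by (intro sum.cong refl)
  also have "\<dots> = (\<Sum>a\<le>m. real (m choose a) * (\<Sum>b\<le>m. real (m choose b) * F (2 * (real a + real b - real m)) (2 * (real a - real b))))"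
    using sum_Pow_card[OF finite_S, of "\<lambda>a. \<Sum>b\<le>m. real (m choose b) * F (2 * (real a + real b - real m)) (2 * (real a - real b))"]
    unfolding cS .
  finally show ?thesis by (simp add: sum_distrib_left mult.assoc)
qed

text \<open>For \<alpha> < 0 criticality reads \<beta> = 2 + \<alpha>. The exponent then splits into
  a critical Curie-Weiss term for each block plus \<alpha> (a + b - m)^2 / m, which is
  \<open>count_weight\<close> with c = -\<alpha>.\<close>

lemma contrast_anticoncentration:
  assumes neg: "\<alpha> < 0"
  defines "m \<equiv> N div 2"
  assumes m: "2 \<le> m" and L: "0 < L" "L ^ 4 = real m ^ 3" "8 * L \<le> real m" "sqrt (real m) \<le> L" and x: "0 \<le> x"
  shows "expect (\<lambda>\<sigma>. of_bool (\<bar>block_contrast N S \<sigma>\<bar> < 2 * x))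
    \<le> exp 258 * (1 + exp (- \<alpha>) / - \<alpha>) * (2 * x + 1) / L"
proof -
  have N: "real N = 2 * real m" using N_even by (auto simp: m_def elim!: evenE)
  have ab: "\<beta> = 2 + \<alpha>" using critical neg by simp
  define W where "W u v = exp (((\<alpha> + \<beta>) / 2 * u\<^sup>2 + (\<beta> - \<alpha>) / 2 * v\<^sup>2) / (2 * real N))" for u v
  have Wc: "real (m choose a) * real (m choose b) * W (2 * (real a + real b - real m)) (2 * (real a - real b))
    = count_weight (- \<alpha>) m a b" for a b
  proof -
    have "((\<alpha> + \<beta>) / 2 * (2 * (real a + real b - real m))\<^sup>2 + (\<beta> - \<alpha>) / 2 * (2 * (real a - real b))\<^sup>2) / (2 * real N)
      = (2 * real a - real m)\<^sup>2 / (2 * real m) + (2 * real b - real m)\<^sup>2 / (2 * real m)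
        + - (- \<alpha> * (real a + real b - real m)\<^sup>2 / real m)"
      unfolding ab N using m by (simp add: divide_simps) (simp add: power2_eq_square algebra_simps)
    then show ?thesis unfolding W_def count_weight_def critical_binomial_def by (simp add: exp_add mult_ac)
  qed
  have w: "weight \<sigma> = W (magnetization N \<sigma>) (block_contrast N S \<sigma>)" for \<sigma>
    unfolding weight_def W_def block_hamiltonian_eq ..
  have Z: "(\<Sum>\<sigma>\<in>spin_configs N. weight \<sigma>) = (\<Sum>a\<le>m. \<Sum>b\<le>m. count_weight (- \<alpha>) m a b)"
    unfolding w sum_spin_configs_counts[of W] m_def[symmetric] Wc ..
  have "(\<Sum>\<sigma>\<in>spin_configs N. weight \<sigma> * of_bool (\<bar>block_contrast N S \<sigma>\<bar> < 2 * x))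
      = (\<Sum>a\<le>m. \<Sum>b\<le>m. count_weight (- \<alpha>) m a b * of_bool (\<bar>real a - real b\<bar> < x))"
  proof -
    have "\<bar>2 * (real a - real b)\<bar> < 2 * x \<longleftrightarrow> \<bar>real a - real b\<bar> < x" for a b
      unfolding abs_mult by simp
    then show ?thesis
      unfolding w sum_spin_configs_counts[of "\<lambda>u v. W u v * of_bool (\<bar>v\<bar> < 2 * x)"] m_def[symmetric] mult.assoc[symmetric] Wc
      by simp
  qed
  also have "\<dots> \<le> exp 258 * (1 + exp (- \<alpha>) / - \<alpha>) * (2 * x + 1) / L * (\<Sum>\<sigma>\<in>spin_configs N. weight \<sigma>)"
    unfolding Z using neg critical alpha_le m L x by (intro count_weight_anticoncentration) auto
  finally show ?thesis by (rule expect_le)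
qed

end

section \<open>Recovery\<close>

lemma recovery_antiferromagnetic:
  fixes \<alpha> \<beta> :: real
  assumes ab: "0 < \<beta>" "\<bar>\<alpha>\<bar> \<le> \<beta>" "\<bar>\<alpha>\<bar> + \<beta> = 2" and neg: "\<alpha> < 0"
  shows "\<exists>C > 0. \<forall>N S \<delta> n. even N \<and> N > 0 \<and> S \<subseteq> {0..<N} \<and> card S = N div 2 \<and> 0 < \<delta> \<and> \<delta> < 1 \<and>
      real n \<ge> C * sqrt (real N) * ln (real N / \<delta>) \<longrightarrow> recovery_prob N \<alpha> \<beta> S n best_half \<ge> 1 - \<delta>"
proof -
  define c where "c = (1 - exp (- 1)) / (3 * energy_const)"
  define D where "D = exp 258 * (1 + exp (- \<alpha>) / - \<alpha>)"
  have c0: "0 < c" by (simp add: c_def)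
  have D0: "1 \<le> D"
  proof -
    have "0 \<le> exp (- \<alpha>) / - \<alpha>" using neg by (intro divide_nonneg_pos) auto
    then have "1 * 1 \<le> exp 258 * (1 + exp (- \<alpha>) / - \<alpha>)" by (intro mult_mono) auto
    then show ?thesis by (simp add: D_def)
  qed
  have "1 \<le> energy_const" unfolding energy_const_def by (intro one_le_power) simp
  then have "c \<le> (1 - exp (- 1)) / 1" unfolding c_def by (intro divide_left_mono) auto
  also have "\<dots> \<le> 1" by simp
  finally have c1: "c \<le> 1" .
  \<comment> \<open>Chosen so that the main term 2D\<epsilon> of the anticoncentration bound at x =
    \<epsilon> L is c/8, half of what \<open>recovery_critical\<close> allows.\<close>
  define \<epsilon> where "\<epsilon> = c / (16 * D)"
  have e0: "0 < \<epsilon>" "\<epsilon> \<le> 1" using c0 c1 D0 by (auto simp: \<epsilon>_def divide_le_eq)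
  \<comment> \<open>The value 64 makes 8L at most m, and 8D/c makes the remaining term D/L at most
    c/8.\<close>
  define Q where "Q = max 64 (8 * D / c)"
  \<comment> \<open>96 = 12 * 8, the 8 coming from the denominator of \<theta>. The second entry
    covers bounded N, where N is at most 2 Q^2 sqrt N and the general bound suffices.\<close>
  define C where "C = max (96 / (\<epsilon>\<^sup>2 * c)) (48 * energy_const / (\<beta> - \<alpha>)\<^sup>2 * (2 * Q\<^sup>2))"
  have C0: "0 < C" using e0 c0 by (simp add: C_def less_max_iff_disj)
  have "1 - \<delta> \<le> recovery_prob N \<alpha> \<beta> S n best_half"
    if N: "even N" "N > 0" "S \<subseteq> {0..<N}" "card S = N div 2" and \<delta>: "0 < \<delta>" "\<delta> < 1"
      and n: "C * sqrt (real N) * ln (real N / \<delta>) \<le> real n" for N S \<delta> n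
  proof -
    interpret block_spin \<alpha> \<beta> N S using ab N by unfold_locales auto
    define m where "m = N div 2"
    have Nm: "real N = 2 * real m" using N by (auto simp: m_def elim!: evenE)
    have m1: "1 \<le> m" using N by (auto simp: m_def elim!: evenE)
    have ln0: "0 \<le> ln (real N / \<delta>)" using \<delta> Nm m1 by (intro ln_ge_zero) (simp add: field_simps)
    show ?thesis
    proof (cases "Q \<le> sqrt (real m)")
      case False
      have "sqrt (real m) < Q" using False by simp
      then have "(sqrt (real m))\<^sup>2 \<le> Q\<^sup>2" by (intro power_mono) auto
      then have NQ: "real N \<le> 2 * Q\<^sup>2" by (simp add: Nm)
      have "1 \<le> sqrt (real N)" using Nm m1 by simp
      then have "real N * 1 \<le> (2 * Q\<^sup>2) * sqrt (real N)" using NQ by (intro mult_mono) auto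
      then have "48 * energy_const / (\<beta> - \<alpha>)\<^sup>2 * real N \<le> 48 * energy_const / (\<beta> - \<alpha>)\<^sup>2 * ((2 * Q\<^sup>2) * sqrt (real N))"
        by (intro mult_left_mono) (auto simp: less_imp_le)
      also have "\<dots> = 48 * energy_const / (\<beta> - \<alpha>)\<^sup>2 * (2 * Q\<^sup>2) * sqrt (real N)" by simp
      also have "\<dots> \<le> C * sqrt (real N)" by (intro mult_right_mono) (auto simp: C_def)
      finally have "48 * energy_const / (\<beta> - \<alpha>)\<^sup>2 * real N * ln (real N / \<delta>) \<le> C * sqrt (real N) * ln (real N / \<delta>)"
        using ln0 by (rule mult_right_mono)
      then show ?thesis using n neg ab by (intro recovery_general \<delta>) auto
    next
      case True
      define R where "R = sqrt (real m)"
      define L where "L = R * sqrt R"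
      have R: "64 \<le> R" "8 * D / c \<le> R" "R\<^sup>2 = real m" using True by (auto simp: R_def Q_def)
      have sR: "8 \<le> sqrt R" using R(1) real_sqrt_le_mono[of 64 R] by simp
      have L0: "0 < L" using R(1) by (simp add: L_def)
      have L2: "L\<^sup>2 = R ^ 3" using R(1) by (simp add: L_def power_mult_distrib power2_eq_square power3_eq_cube)
      have L4: "L ^ 4 = real m ^ 3"
      proof -
        have "L ^ 4 = (L\<^sup>2)\<^sup>2" by simp
        also have "\<dots> = (R\<^sup>2) ^ 3" unfolding L2 by (simp flip: power_mult)
        finally show ?thesis by (simp add: R(3))
      qed
      have "sqrt R * 8 \<le> sqrt R * sqrt R" using sR R(1) by (intro mult_left_mono) auto
      then have "8 * sqrt R \<le> R" using R(1) by simp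
      then have "R * (8 * sqrt R) \<le> R * R" using R(1) by (intro mult_left_mono) auto
      then have L8: "8 * L \<le> real m" by (simp add: L_def R(3)[symmetric] power2_eq_square mult_ac)
      have "R * 1 \<le> R * sqrt R" using R(1) sR by (intro mult_left_mono) auto
      then have RL: "R \<le> L" by (simp add: L_def)
      have "64\<^sup>2 \<le> R\<^sup>2" using R(1) by (intro power_mono) auto
      then have m2: "2 \<le> m" using R(3) by simp
      define x where "x = \<epsilon> * L"
      have x0: "0 \<le> x" using e0 L0 by (simp add: x_def)
      have "expect (\<lambda>\<sigma>. of_bool (\<bar>block_contrast N S \<sigma>\<bar> < 2 * x)) \<le> D * (2 * x + 1) / L"
        unfolding D_def using contrast_anticoncentration[OF neg, of L x] m2 L0 L4 L8 RL x0 by (simp add: m_def R_def)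
      also have "\<dots> = 2 * D * \<epsilon> + D / L" using L0 by (simp add: x_def field_simps)
      also have "\<dots> \<le> c / 8 + c / 8"
      proof (rule add_mono)
        show "2 * D * \<epsilon> \<le> c / 8" using D0 by (simp add: \<epsilon>_def)
        have "8 * D \<le> c * L" using R(2) RL c0 by (metis mult.commute order_trans pos_divide_le_eq)
        then show "D / L \<le> c / 8" using L0 by (simp add: field_simps)
      qed
      finally have small: "expect (\<lambda>\<sigma>. of_bool (\<bar>block_contrast N S \<sigma>\<bar> < 2 * x)) \<le> c / 4" by simp
      \<comment> \<open>Since L^2 = R^3 and 4 * rate * x = x / R^2, the square of 4 * rate * x is
        \<epsilon>^2 / R = 8\<theta>. Thus the quadratic bound on cosh gives 1 + 4\<theta>, which
        dominates exp(2\<theta>) because 2\<theta> is at most 1.\<close>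
      define \<theta> where "\<theta> = \<epsilon>\<^sup>2 / (8 * R)"
      have th0: "0 \<le> \<theta>" using R(1) by (simp add: \<theta>_def)
      have "\<epsilon>\<^sup>2 \<le> 1" using e0 by (simp add: power_le_one)
      then have th1: "\<theta> \<le> 1 / 2" using R(1) by (simp add: \<theta>_def divide_le_eq)
      have th2: "exp (2 * \<theta>) \<le> cosh (4 * rate * x)"
      proof -
        have "exp (2 * \<theta>) \<le> 1 + 2 * \<theta> + (2 * \<theta>)\<^sup>2" using th0 th1 by (intro exp_bound) auto
        also have "(2 * \<theta>)\<^sup>2 \<le> 2 * \<theta>" using th0 th1 mult_left_mono[of "2 * \<theta>" 1 "2 * \<theta>"] by (simp add: power2_eq_square)
        also have "1 + 2 * \<theta> + 2 * \<theta> = 1 + (4 * rate * x)\<^sup>2 / 2"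
        proof -
          have "\<beta> - \<alpha> = 2" using ab neg by simp
          then have "4 * rate * x = x / R\<^sup>2" using m1 by (simp add: rate_def Nm R(3))
          then have "(4 * rate * x)\<^sup>2 = \<epsilon>\<^sup>2 * R ^ 3 / R ^ 4" by (simp add: x_def power_divide power_mult_distrib L2 flip: power_mult)
          also have "\<dots> = \<epsilon>\<^sup>2 / R" using R(1) by (simp add: power_eq_if)
          finally show ?thesis by (simp add: \<theta>_def)
        qed
        also have "\<dots> \<le> cosh (4 * rate * x)" by (rule cosh_ge_quadratic)
        finally show ?thesis by simp
      qed
      have "12 * ln (real N / \<delta>) \<le> \<theta> * c * real n"
      proof -
        have "R \<le> sqrt (real N)" by (simp add: R_def Nm)
        then have "96 / (\<epsilon>\<^sup>2 * c) * R \<le> C * sqrt (real N)"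
          using C0 R(1) by (intro mult_mono) (auto simp: C_def)
        then have "96 / (\<epsilon>\<^sup>2 * c) * R * ln (real N / \<delta>) \<le> C * sqrt (real N) * ln (real N / \<delta>)"
          using ln0 by (rule mult_right_mono)
        then have "96 / (\<epsilon>\<^sup>2 * c) * R * ln (real N / \<delta>) \<le> real n" using n by linarith
        then have "\<theta> * c * (96 / (\<epsilon>\<^sup>2 * c) * R * ln (real N / \<delta>)) \<le> \<theta> * c * real n"
          using th0 c0 by (intro mult_left_mono) auto
        moreover have "\<theta> * c * (96 / (\<epsilon>\<^sup>2 * c) * R * ln (real N / \<delta>)) = 12 * ln (real N / \<delta>)"
          using R(1) e0 c0 by (simp add: \<theta>_def)
        ultimately show ?thesis by simp
      qed
      then show ?thesis using small th0 th1 th2 x0 unfolding c_def by (intro recovery_critical[OF \<delta>, of x \<theta>]) auto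
    qed
  qed
  then show ?thesis using C0 by blast
qed

theorem theorem1p3:
  fixes \<alpha> \<beta> :: real
  assumes "\<beta> > 0" and "\<bar>\<alpha>\<bar> \<le> \<beta>" and "\<alpha> < \<beta>" and "\<alpha> \<noteq> 0" and "\<bar>\<alpha>\<bar> + \<beta> = 2"
  shows "(\<alpha> > 0 \<longrightarrow>
           (\<exists>C3 > 0. \<exists>alg. \<forall>N S \<delta> n.
              even N \<and> N > 0 \<and> S \<subseteq> {0..<N} \<and> card S = N div 2 \<and> 0 < \<delta> \<and> \<delta> < 1 \<and>
              real n \<ge> C3 * real N * ln (real N / \<delta>)
              \<longrightarrow> recovery_prob N \<alpha> \<beta> S n alg \<ge> 1 - \<delta>))
       \<and> (\<alpha> < 0 \<longrightarrow>
           (\<exists>C4 > 0. \<exists>alg. \<forall>N S \<delta> n.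
              even N \<and> N > 0 \<and> S \<subseteq> {0..<N} \<and> card S = N div 2 \<and> 0 < \<delta> \<and> \<delta> < 1 \<and>
              real n \<ge> C4 * sqrt (real N) * ln (real N / \<delta>)
              \<longrightarrow> recovery_prob N \<alpha> \<beta> S n alg \<ge> 1 - \<delta>))"
proof (intro conjI impI)
  define C where "C = 48 * energy_const / (\<beta> - \<alpha>)\<^sup>2"
  have "0 < C" using assms(3) by (simp add: C_def)
  moreover have "1 - \<delta> \<le> recovery_prob N \<alpha> \<beta> S n best_half"
    if "even N" "N > 0" "S \<subseteq> {0..<N}" "card S = N div 2" "0 < \<delta>" "\<delta> < 1" "C * real N * ln (real N / \<delta>) \<le> real n"
    for N S \<delta> n
  proof -
    interpret block_spin \<alpha> \<beta> N S using assms that by unfold_locales auto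
    show ?thesis using that assms(3) unfolding C_def by (intro recovery_general) auto
  qed
  ultimately show "\<exists>C3 > 0. \<exists>alg. \<forall>N S \<delta> n.
      even N \<and> N > 0 \<and> S \<subseteq> {0..<N} \<and> card S = N div 2 \<and> 0 < \<delta> \<and> \<delta> < 1 \<and>
      real n \<ge> C3 * real N * ln (real N / \<delta>) \<longrightarrow> recovery_prob N \<alpha> \<beta> S n alg \<ge> 1 - \<delta>"
    by blast
next
  assume "\<alpha> < 0"
  from recovery_antiferromagnetic[OF assms(1,2,5) this]
  show "\<exists>C4 > 0. \<exists>alg. \<forall>N S \<delta> n.
      even N \<and> N > 0 \<and> S \<subseteq> {0..<N} \<and> card S = N div 2 \<and> 0 < \<delta> \<and> \<delta> < 1 \<and>
      real n \<ge> C4 * sqrt (real N) * ln (real N / \<delta>) \<longrightarrow> recovery_prob N \<alpha> \<beta> S n alg \<ge> 1 - \<delta>"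
    by blast
qed

end
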